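(* Let $\Gamma$ be a group. The category $\mathbf{B\widetilde{orn}Coarse}$ of generalized bornological coarse spaces and the category $\Gamma\mathbf{B\widetilde{orn}Coarse}$ of $\Gamma$-equivariant generalized bornological coarse spaces are both complete and co-complete.
   Context: For a set $X$, subsets $U,V\subseteq X\times X$ and $B\subseteq X$ put $U^{-1}=\{(x,y)\mid (y,x)\in U\}$, $U\circ V=\{(x,y)\mid \exists z\in X:(x,z)\in U,(z,y)\in V\}$, and $U[B]=\{x\in X\mid\exists b\in B:(x,b)\in U\}$. A generalized bornology on $X$ is a non-empty set $\mathcal{B}_X$ of subsets of $X$ that is closed under taking subsets and finite unions (points are not required to be bounded); its elements are called bounded subsets. A coarse structure on $X$ is a set $\mathcal{C}_X$ of subsets of $X\times X$ that contains the diagonal and is closed under taking subsets, finite unions, inverses and compositions; its elements are called entourages. They are compatible if $U[B]\in\mathcal{B}_X$ for all $U\in\mathcal{C}_X$, $B\in\mathcal{B}_X$. A generalized bornological coarse space is a set $X$ with a coarse structure $\mathcal{C}_X$ and a compatible generalized bornology $\mathcal{B}_X$. A morphism $f\colon X\to Y$ is a map of sets that is proper ($f^{-1}(B)\in\mathcal{B}_X$ for all $B\in\mathcal{B}_Y$) and controlled ($(f\times f)(U)\in\mathcal{C}_Y$ for all $U\in\mathcal{C}_X$). This gives the category $\mathbf{B\widetilde{orn}Coarse}$. A $\Gamma$-equivariant generalized bornological coarse space is a generalized bornological coarse space $X$ with an action of $\Gamma$ by automorphisms such that every entourage of $X$ is contained in a $\Gamma$-invariant entourage. With $\Gamma$-equivariant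 (proper and controlled) morphisms these form the category $\Gamma\mathbf{B\widetilde{orn}Coarse}$. *)

theory Defs
  imports "HOL-Algebra.Group_Action" "HOL-Library.Equipollence"
begin

section \<open>Categories, limits and colimits\<close>

(* Hom-sets need not be disjoint, so composition takes the three objects as arguments:
   Comp C X Y Z g f is the composite g \<circ> f of f : X \<rightarrow> Y and g : Y \<rightarrow> Z. *)
record ('o, 'm) cat =
  Ob :: "'o set"
  Hom :: "'o \<Rightarrow> 'o \<Rightarrow> 'm set"
  Ident :: "'o \<Rightarrow> 'm"
  Comp :: "'o \<Rightarrow> 'o \<Rightarrow> 'o \<Rightarrow> 'm \<Rightarrow> 'm \<Rightarrow> 'm"

definition category :: "('o, 'm) cat \<Rightarrow> bool" where
  "category C \<longleftrightarrow>
     (\<forall>X\<in>Ob C. Ident C X \<in> Hom C X X) \<and>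
     (\<forall>X\<in>Ob C. \<forall>Y\<in>Ob C. \<forall>Z\<in>Ob C. \<forall>f\<in>Hom C X Y. \<forall>g\<in>Hom C Y Z.
        Comp C X Y Z g f \<in> Hom C X Z) \<and>
     (\<forall>X\<in>Ob C. \<forall>Y\<in>Ob C. \<forall>f\<in>Hom C X Y.
        Comp C X X Y f (Ident C X) = f \<and> Comp C X Y Y (Ident C Y) f = f) \<and>
     (\<forall>W\<in>Ob C. \<forall>X\<in>Ob C. \<forall>Y\<in>Ob C. \<forall>Z\<in>Ob C.
        \<forall>f\<in>Hom C W X. \<forall>g\<in>Hom C X Y. \<forall>h\<in>Hom C Y Z.
        Comp C W Y Z h (Comp C W X Y g f) = Comp C W X Z (Comp C X Y Z h g) f)"

definition automorphism :: "('o, 'm) cat \<Rightarrow> 'o \<Rightarrow> 'm \<Rightarrow> bool" where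
  "automorphism C X f \<longleftrightarrow> f \<in> Hom C X X \<and>
     (\<exists>g\<in>Hom C X X. Comp C X X X g f = Ident C X \<and> Comp C X X X f g = Ident C X)"

record ('i, 'k, 'o, 'm) diagram =
  DOb :: "'i \<Rightarrow> 'o"
  DMor :: "'i \<Rightarrow> 'i \<Rightarrow> 'k \<Rightarrow> 'm"

definition is_diagram ::
    "('i, 'k) cat \<Rightarrow> ('o, 'm) cat \<Rightarrow> ('i, 'k, 'o, 'm) diagram \<Rightarrow> bool" where
  "is_diagram J C D \<longleftrightarrow>
     (\<forall>i\<in>Ob J. DOb D i \<in> Ob C) \<and>
     (\<forall>i\<in>Ob J. \<forall>j\<in>Ob J. \<forall>u\<in>Hom J i j. DMor D i j u \<in> Hom C (DOb D i) (DOb D j)) \<and>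
     (\<forall>i\<in>Ob J. DMor D i i (Ident J i) = Ident C (DOb D i)) \<and>
     (\<forall>i\<in>Ob J. \<forall>j\<in>Ob J. \<forall>k\<in>Ob J. \<forall>u\<in>Hom J i j. \<forall>v\<in>Hom J j k.
        DMor D i k (Comp J i j k v u) =
          Comp C (DOb D i) (DOb D j) (DOb D k) (DMor D j k v) (DMor D i j u))"

definition is_cone ::
    "('i, 'k) cat \<Rightarrow> ('o, 'm) cat \<Rightarrow> ('i, 'k, 'o, 'm) diagram \<Rightarrow> 'o \<Rightarrow> ('i \<Rightarrow> 'm) \<Rightarrow> bool" where
  "is_cone J C D L p \<longleftrightarrow> L \<in> Ob C \<and>
     (\<forall>i\<in>Ob J. p i \<in> Hom C L (DOb D i)) \<and>
     (\<forall>i\<in>Ob J. \<forall>j\<in>Ob J. \<forall>u\<in>Hom J i j.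
        Comp C L (DOb D i) (DOb D j) (DMor D i j u) (p i) = p j)"

definition is_cocone ::
    "('i, 'k) cat \<Rightarrow> ('o, 'm) cat \<Rightarrow> ('i, 'k, 'o, 'm) diagram \<Rightarrow> 'o \<Rightarrow> ('i \<Rightarrow> 'm) \<Rightarrow> bool" where
  "is_cocone J C D L p \<longleftrightarrow> L \<in> Ob C \<and>
     (\<forall>i\<in>Ob J. p i \<in> Hom C (DOb D i) L) \<and>
     (\<forall>i\<in>Ob J. \<forall>j\<in>Ob J. \<forall>u\<in>Hom J i j.
        Comp C (DOb D i) (DOb D j) L (p j) (DMor D i j u) = p i)"

definition is_limit ::
    "('i, 'k) cat \<Rightarrow> ('o, 'm) cat \<Rightarrow> ('i, 'k, 'o, 'm) diagram \<Rightarrow> 'o \<Rightarrow> ('i \<Rightarrow> 'm) \<Rightarrow> bool" where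
  "is_limit J C D L p \<longleftrightarrow> is_cone J C D L p \<and>
     (\<forall>X q. is_cone J C D X q \<longrightarrow>
        (\<exists>!h. h \<in> Hom C X L \<and> (\<forall>i\<in>Ob J. Comp C X L (DOb D i) (p i) h = q i)))"

definition is_colimit ::
    "('i, 'k) cat \<Rightarrow> ('o, 'm) cat \<Rightarrow> ('i, 'k, 'o, 'm) diagram \<Rightarrow> 'o \<Rightarrow> ('i \<Rightarrow> 'm) \<Rightarrow> bool" where
  "is_colimit J C D L p \<longleftrightarrow> is_cocone J C D L p \<and>
     (\<forall>X q. is_cocone J C D X q \<longrightarrow>
        (\<exists>!h. h \<in> Hom C L X \<and> (\<forall>i\<in>Ob J. Comp C (DOb D i) L X h (p i) = q i)))"

section \<open>Size\<close>

(* HOL has no set of all sets, so "small" is relative to two families: the sets in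
   \<U> may carry spaces, the sets in \<I> may index limits and colimits.  All that is required is
   that \<U> contains, up to bijection, every set that injects into one of its members, and
   every product and disjoint union of an \<I>-indexed family of its members.
   The classical reading is \<I> = \<U>, a Grothendieck universe (e.g. all sets of cardinality below an
   inaccessible one).  HOL does not prove that there are uncountable such universes, and two
   separate families avoid assuming it: by set_universe_exists below, every type of indices
   and every type of points is covered outright. *)
definition set_universe :: "'i set set \<Rightarrow> 'u set set \<Rightarrow> bool" where
  "set_universe \<I> \<U> \<longleftrightarrow>
     (\<forall>A\<in>\<U>. \<forall>B. B \<lesssim> A \<longrightarrow> B \<in> \<U>) \<and>
     (\<forall>I\<in>\<I>. \<forall>A. (\<forall>i\<in>I. A i \<in> \<U>) \<longrightarrow>
        (\<exists>P\<in>\<U>. (\<Pi>\<^sub>E i\<in>I. A i) \<lesssim> P) \<and> (\<exists>S\<in>\<U>. (SIGMA i:I. A i) \<lesssim> S))"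

(* Any given type of points embeds: a \<mapsto> {([], a)} maps 'a into ('i list \<times> 'a) set. *)
lemma set_universe_exists:
  "set_universe (UNIV :: 'i set set) (UNIV :: ('i list \<times> 'a) set set set)"
proof -
  have "(\<Pi>\<^sub>E i\<in>I. A i) \<lesssim> (UNIV :: ('i list \<times> 'a) set set)"
    for I :: "'i set" and A :: "'i \<Rightarrow> ('i list \<times> 'a) set set"
  proof -
    define \<phi> where "\<phi> F = {(i # l, a) | i l a. (l, a) \<in> F i}"
      for F :: "'i \<Rightarrow> ('i list \<times> 'a) set"
    have "F = {(l, a). (i # l, a) \<in> \<phi> G}" if "F = G i" for F G i
      using that by (auto simp: \<phi>_def)
    then have "inj \<phi>"
      by (intro injI ext) metis
    then show ?thesis
      unfolding lepoll_def by (meson inj_on_subset subset_UNIV)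
  qed
  moreover have "(SIGMA i:I. A i) \<lesssim> (UNIV :: ('i list \<times> 'a) set set)"
    for I :: "'i set" and A :: "'i \<Rightarrow> ('i list \<times> 'a) set set"
  proof -
    define \<phi> :: "'i \<times> ('i list \<times> 'a) set \<Rightarrow> ('i list \<times> 'a) set"
      where "\<phi> = (\<lambda>(i, S). {([i], a) | a. True} \<union> {(i # i # l, a) | l a. (l, a) \<in> S})"
    have 1: "([j], a) \<in> \<phi> (i, S) \<longleftrightarrow> j = i" for i j a S
      by (auto simp: \<phi>_def)
    have 2: "(i # i # l, a) \<in> \<phi> (i, S) \<longleftrightarrow> (l, a) \<in> S" for i l a S
      by (auto simp: \<phi>_def)
    have "inj \<phi>"
    proof (rule injI, clarify)
      fix i j S T assume eq: "\<phi> (i, S) = \<phi> (j, T)"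
      then have ij: "i = j" using 1 by metis
      have "(l, a) \<in> S \<longleftrightarrow> (l, a) \<in> T" for l a
        using eq 2[of i l a S] 2[of i l a T] ij by simp
      with ij show "i = j \<and> S = T" by auto
    qed
    then show ?thesis
      unfolding lepoll_def by (meson inj_on_subset subset_UNIV)
  qed
  ultimately show ?thesis
    unfolding set_universe_def by blast
qed

definition small_category :: "'i set set \<Rightarrow> ('i, 'i) cat \<Rightarrow> bool" where
  "small_category \<I> J \<longleftrightarrow> category J \<and> Ob J \<in> \<I> \<and> (\<forall>i\<in>Ob J. \<forall>j\<in>Ob J. Hom J i j \<in> \<I>)"

definition complete_category :: "'i set set \<Rightarrow> ('o, 'm) cat \<Rightarrow> bool" where
  "complete_category \<I> C \<longleftrightarrow> category C \<and>
     (\<forall>J D. small_category \<I> J \<and> is_diagram J C D \<longrightarrow> (\<exists>L p. is_limit J C D L p))"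

definition cocomplete_category :: "'i set set \<Rightarrow> ('o, 'm) cat \<Rightarrow> bool" where
  "cocomplete_category \<I> C \<longleftrightarrow> category C \<and>
     (\<forall>J D. small_category \<I> J \<and> is_diagram J C D \<longrightarrow> (\<exists>L p. is_colimit J C D L p))"

section \<open>Generalized bornological coarse spaces\<close>

definition thickening :: "('u \<times> 'u) set \<Rightarrow> 'u set \<Rightarrow> 'u set" where
  "thickening U B = {x. \<exists>b\<in>B. (x, b) \<in> U}"

definition generalized_bornology :: "'u set \<Rightarrow> 'u set set \<Rightarrow> bool" where
  "generalized_bornology X \<B> \<longleftrightarrow> \<B> \<subseteq> Pow X \<and> \<B> \<noteq> {} \<and>
     (\<forall>A\<in>\<B>. \<forall>A'\<subseteq>A. A' \<in> \<B>) \<and> (\<forall>A\<in>\<B>. \<forall>B\<in>\<B>. A \<union> B \<in> \<B>)"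

definition coarse_structure :: "'u set \<Rightarrow> ('u \<times> 'u) set set \<Rightarrow> bool" where
  "coarse_structure X \<C> \<longleftrightarrow> \<C> \<subseteq> Pow (X \<times> X) \<and> Id_on X \<in> \<C> \<and>
     (\<forall>U\<in>\<C>. \<forall>U'\<subseteq>U. U' \<in> \<C>) \<and> (\<forall>U\<in>\<C>. \<forall>V\<in>\<C>. U \<union> V \<in> \<C>) \<and>
     (\<forall>U\<in>\<C>. U\<inverse> \<in> \<C>) \<and> (\<forall>U\<in>\<C>. \<forall>V\<in>\<C>. U O V \<in> \<C>)"

definition compatible :: "('u \<times> 'u) set set \<Rightarrow> 'u set set \<Rightarrow> bool" where
  "compatible \<C> \<B> \<longleftrightarrow> (\<forall>U\<in>\<C>. \<forall>B\<in>\<B>. thickening U B \<in> \<B>)"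

record 'u bcs =
  points :: "'u set"
  entourages :: "('u \<times> 'u) set set"
  bounded_sets :: "'u set set"

definition is_bcs :: "('u, 'x) bcs_scheme \<Rightarrow> bool" where
  "is_bcs X \<longleftrightarrow> coarse_structure (points X) (entourages X) \<and>
     generalized_bornology (points X) (bounded_sets X) \<and>
     compatible (entourages X) (bounded_sets X)"

definition proper :: "('u, 'x) bcs_scheme \<Rightarrow> ('u, 'x) bcs_scheme \<Rightarrow> ('u \<Rightarrow> 'u) \<Rightarrow> bool" where
  "proper X Y f \<longleftrightarrow> (\<forall>B\<in>bounded_sets Y. f -` B \<inter> points X \<in> bounded_sets X)"

definition controlled :: "('u, 'x) bcs_scheme \<Rightarrow> ('u, 'x) bcs_scheme \<Rightarrow> ('u \<Rightarrow> 'u) \<Rightarrow> bool" where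
  "controlled X Y f \<longleftrightarrow> (\<forall>U\<in>entourages X. map_prod f f ` U \<in> entourages Y)"

(* Maps are extensional (undefined outside the domain), so that equality of morphisms is
   equality of maps on the domain. *)
definition bcs_morphisms :: "('u, 'x) bcs_scheme \<Rightarrow> ('u, 'x) bcs_scheme \<Rightarrow> ('u \<Rightarrow> 'u) set" where
  "bcs_morphisms X Y = {f \<in> points X \<rightarrow>\<^sub>E points Y. proper X Y f \<and> controlled X Y f}"

definition BornCoarse :: "'u set set \<Rightarrow> ('u bcs, 'u \<Rightarrow> 'u) cat" where
  "BornCoarse \<U> =
     \<lparr>Ob = {X. is_bcs X \<and> points X \<in> \<U>},
      Hom = bcs_morphisms,
      Ident = (\<lambda>X. \<lambda>x\<in>points X. x),
      Comp = (\<lambda>X Y Z g f. compose (points X) g f)\<rparr>"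

section \<open>Equivariant generalized bornological coarse spaces\<close>

record ('u, 'g) equivariant_bcs = "'u bcs" +
  action :: "'g \<Rightarrow> 'u \<Rightarrow> 'u"

definition invariant_under ::
    "('g, 'e) monoid_scheme \<Rightarrow> ('g \<Rightarrow> 'u \<Rightarrow> 'u) \<Rightarrow> ('u \<times> 'u) set \<Rightarrow> bool" where
  "invariant_under \<Gamma> \<alpha> U \<longleftrightarrow> (\<forall>\<gamma>\<in>carrier \<Gamma>. map_prod (\<alpha> \<gamma>) (\<alpha> \<gamma>) ` U = U)"

definition is_equivariant_bcs ::
    "('g, 'e) monoid_scheme \<Rightarrow> ('u, 'g) equivariant_bcs \<Rightarrow> bool" where
  "is_equivariant_bcs \<Gamma> X \<longleftrightarrow> is_bcs X \<and>
     group_action \<Gamma> (points X) (action X) \<and>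
     (\<forall>\<gamma>\<in>carrier \<Gamma>. automorphism (BornCoarse UNIV) (bcs.truncate X) (action X \<gamma>)) \<and>
     (\<forall>U\<in>entourages X. \<exists>V\<in>entourages X. invariant_under \<Gamma> (action X) V \<and> U \<subseteq> V)"

definition equivariant_morphisms ::
    "('g, 'e) monoid_scheme \<Rightarrow> ('u, 'g) equivariant_bcs \<Rightarrow> ('u, 'g) equivariant_bcs \<Rightarrow>
     ('u \<Rightarrow> 'u) set" where
  "equivariant_morphisms \<Gamma> X Y =
     {f \<in> bcs_morphisms X Y.
        \<forall>\<gamma>\<in>carrier \<Gamma>. \<forall>x\<in>points X. f (action X \<gamma> x) = action Y \<gamma> (f x)}"

definition EquivariantBornCoarse ::
    "('g, 'e) monoid_scheme \<Rightarrow> 'u set set \<Rightarrow> (('u, 'g) equivariant_bcs, 'u \<Rightarrow> 'u) cat" where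
  "EquivariantBornCoarse \<Gamma> \<U> =
     \<lparr>Ob = {X. is_equivariant_bcs \<Gamma> X \<and> points X \<in> \<U>},
      Hom = equivariant_morphisms \<Gamma>,
      Ident = (\<lambda>X. \<lambda>x\<in>points X. x),
      Comp = (\<lambda>X Y Z g f. compose (points X) g f)\<rparr>"

end

theory Submission
  imports Defs "HOL-Algebra.Elementary_Groups"
begin

text \<open>
  Limits and colimits are computed on underlying sets.  A limit carries the initial structure: a
  relation is an entourage iff all its projections are, and the bornology is generated by the
  preimages of bounded sets.  A colimit carries the coarse structure generated by the images of
  entourages; its bornology cannot be the final one for the maps alone, since it must be compatible
  with that coarse structure, so a set counts as bounded iff the preimages of all its thickenings
  are bounded.  The group acts on both through the universal properties, and the invariant
  entourages of the factors provide invariant ones.  The non-equivariant case follows from the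
  equivariant one for the trivial group, because forgetting a trivial action is fully faithful and
  surjective on objects.
\<close>

text \<open>That points may be unbounded is what makes both constructions possible. The limit of the
  empty diagram is a point whose only bounded set is empty; if the point were bounded, only bounded
  spaces would have a proper map to it. In a colimit, a point with an unbounded preimage in some
  factor must itself be unbounded.

  The other obstacle is typing. All spaces have points of the one type \<open>'u\<close>, whereas
  families and tagged points have the types \<open>'i \<Rightarrow> 'u\<close> and
  \<open>'i \<times> 'u\<close>. An unknown injection carries them back into a member of
  \<open>\<U>\<close>, so the underlying set is known only through the properties of its maps
  \<open>p i\<close>. The structures are therefore defined for an arbitrary family of maps, which
  lets a diagram be treated at once, without a detour through products and equalizers.\<close>

lemma is_bcsD:
  assumes "is_bcs X"
  shows entourage_subset: "U \<in> entourages X \<Longrightarrow> U \<subseteq> points X \<times> points X"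
    and entourage_diag: "Id_on (points X) \<in> entourages X"
    and entourage_mono: "U \<in> entourages X \<Longrightarrow> V \<subseteq> U \<Longrightarrow> V \<in> entourages X"
    and entourage_Un: "U \<in> entourages X \<Longrightarrow> V \<in> entourages X \<Longrightarrow> U \<union> V \<in> entourages X"
    and entourage_converse: "U \<in> entourages X \<Longrightarrow> U\<inverse> \<in> entourages X"
    and entourage_comp: "U \<in> entourages X \<Longrightarrow> V \<in> entourages X \<Longrightarrow> U O V \<in> entourages X"
    and bounded_mono: "B \<in> bounded_sets X \<Longrightarrow> A \<subseteq> B \<Longrightarrow> A \<in> bounded_sets X"
    and bounded_Un: "A \<in> bounded_sets X \<Longrightarrow> B \<in> bounded_sets X \<Longrightarrow> A \<union> B \<in> bounded_sets X"
    and bounded_empty: "{} \<in> bounded_sets X"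
    and bounded_thickening: "U \<in> entourages X \<Longrightarrow> B \<in> bounded_sets X \<Longrightarrow> thickening U B \<in> bounded_sets X"
proof -
  note X = assms[unfolded is_bcs_def coarse_structure_def generalized_bornology_def compatible_def]
  show "U \<in> entourages X \<Longrightarrow> U \<subseteq> points X \<times> points X" using X by auto
  show "Id_on (points X) \<in> entourages X" using X by simp
  show "U \<in> entourages X \<Longrightarrow> V \<subseteq> U \<Longrightarrow> V \<in> entourages X" using X by simp
  show "U \<in> entourages X \<Longrightarrow> V \<in> entourages X \<Longrightarrow> U \<union> V \<in> entourages X" using X by simp
  show "U \<in> entourages X \<Longrightarrow> U\<inverse> \<in> entourages X" using X by simp
  show "U \<in> entourages X \<Longrightarrow> V \<in> entourages X \<Longrightarrow> U O V \<in> entourages X" using X by simp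
  show mono: "B \<in> bounded_sets X \<Longrightarrow> A \<subseteq> B \<Longrightarrow> A \<in> bounded_sets X" for A B using X by simp
  show "A \<in> bounded_sets X \<Longrightarrow> B \<in> bounded_sets X \<Longrightarrow> A \<union> B \<in> bounded_sets X" using X by simp
  obtain C where "C \<in> bounded_sets X" using X by auto
  then show "{} \<in> bounded_sets X" by (rule mono) simp
  show "U \<in> entourages X \<Longrightarrow> B \<in> bounded_sets X \<Longrightarrow> thickening U B \<in> bounded_sets X" using X by simp
qed

lemma is_bcsI:
  assumes "\<And>U. U \<in> entourages X \<Longrightarrow> U \<subseteq> points X \<times> points X"
    and "Id_on (points X) \<in> entourages X"
    and "\<And>U V. U \<in> entourages X \<Longrightarrow> V \<subseteq> U \<Longrightarrow> V \<in> entourages X"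
    and "\<And>U V. U \<in> entourages X \<Longrightarrow> V \<in> entourages X \<Longrightarrow> U \<union> V \<in> entourages X"
    and "\<And>U. U \<in> entourages X \<Longrightarrow> U\<inverse> \<in> entourages X"
    and "\<And>U V. U \<in> entourages X \<Longrightarrow> V \<in> entourages X \<Longrightarrow> U O V \<in> entourages X"
    and "\<And>B. B \<in> bounded_sets X \<Longrightarrow> B \<subseteq> points X"
    and "\<And>A B. B \<in> bounded_sets X \<Longrightarrow> A \<subseteq> B \<Longrightarrow> A \<in> bounded_sets X"
    and "\<And>A B. A \<in> bounded_sets X \<Longrightarrow> B \<in> bounded_sets X \<Longrightarrow> A \<union> B \<in> bounded_sets X"
    and "{} \<in> bounded_sets X"
    and "\<And>U B. U \<in> entourages X \<Longrightarrow> B \<in> bounded_sets X \<Longrightarrow> thickening U B \<in> bounded_sets X"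
  shows "is_bcs X"
proof -
  have "entourages X \<subseteq> Pow (points X \<times> points X)" "bounded_sets X \<subseteq> Pow (points X)" "bounded_sets X \<noteq> {}"
    using assms(1,7,10) by auto
  moreover have "\<forall>U\<in>entourages X. \<forall>V\<subseteq>U. V \<in> entourages X" "\<forall>B\<in>bounded_sets X. \<forall>A\<subseteq>B. A \<in> bounded_sets X"
    using assms(3,8) by simp_all
  ultimately show ?thesis
    unfolding is_bcs_def coarse_structure_def generalized_bornology_def compatible_def
    by (simp add: assms(2,4,5,6,9,11))
qed

section \<open>Proper controlled maps and their composition\<close>

lemma bcs_morphismsI:
  assumes "f \<in> points X \<rightarrow>\<^sub>E points Y"
    and "\<And>B. B \<in> bounded_sets Y \<Longrightarrow> f -` B \<inter> points X \<in> bounded_sets X"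
    and "\<And>U. U \<in> entourages X \<Longrightarrow> map_prod f f ` U \<in> entourages Y"
  shows "f \<in> bcs_morphisms X Y"
  using assms by (simp add: bcs_morphisms_def proper_def controlled_def)

lemma bcs_morphismsD:
  assumes "f \<in> bcs_morphisms X Y"
  shows bcs_morphism_PiE: "f \<in> points X \<rightarrow>\<^sub>E points Y"
    and bcs_morphism_vimage: "B \<in> bounded_sets Y \<Longrightarrow> f -` B \<inter> points X \<in> bounded_sets X"
    and bcs_morphism_image: "U \<in> entourages X \<Longrightarrow> map_prod f f ` U \<in> entourages Y"
  using assms by (simp_all add: bcs_morphisms_def proper_def controlled_def)

lemma bcs_morphism_in: "f \<in> bcs_morphisms X Y \<Longrightarrow> x \<in> points X \<Longrightarrow> f x \<in> points Y"
  by (auto simp: bcs_morphisms_def)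

lemma bcs_morphisms_id:
  assumes "is_bcs X"
  shows "(\<lambda>x\<in>points X. x) \<in> bcs_morphisms X X"
proof (rule bcs_morphismsI)
  fix B assume "B \<in> bounded_sets X"
  then show "(\<lambda>x\<in>points X. x) -` B \<inter> points X \<in> bounded_sets X"
    by (rule bounded_mono[OF assms]) auto
next
  fix U assume U: "U \<in> entourages X"
  with entourage_subset[OF assms U] show "map_prod (\<lambda>x\<in>points X. x) (\<lambda>x\<in>points X. x) ` U \<in> entourages X"
    by (elim entourage_mono[OF assms]) auto
qed auto

text \<open>\<open>compose A g f\<close> is \<open>undefined\<close> off \<open>A\<close>, so the
  equation is stated for relations on \<open>A\<close>; entourages of a space with point set
  \<open>A\<close> are such relations.\<close>

lemma map_prod_image_compose:
  assumes "U \<subseteq> A \<times> A"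
  shows "map_prod (compose A g f) (compose A g f) ` U = map_prod g g ` map_prod f f ` U"
proof -
  have "map_prod (compose A g f) (compose A g f) ` U = (map_prod g g \<circ> map_prod f f) ` U"
    using assms by (intro image_cong) (auto simp: compose_def)
  then show ?thesis by (simp add: image_comp)
qed

lemma bcs_morphisms_compose:
  assumes "is_bcs X" and f: "f \<in> bcs_morphisms X Y" and g: "g \<in> bcs_morphisms Y Z"
  shows "compose (points X) g f \<in> bcs_morphisms X Z"
proof (rule bcs_morphismsI)
  show "compose (points X) g f \<in> points X \<rightarrow>\<^sub>E points Z"
    using bcs_morphism_in[OF f] bcs_morphism_in[OF g] by (auto simp: compose_def)
  fix B assume "B \<in> bounded_sets Z"
  then have "f -` (g -` B \<inter> points Y) \<inter> points X \<in> bounded_sets X"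
    by (intro bcs_morphism_vimage[OF f] bcs_morphism_vimage[OF g])
  moreover have "f -` (g -` B \<inter> points Y) \<inter> points X = compose (points X) g f -` B \<inter> points X"
    using bcs_morphism_in[OF f] by (auto simp: compose_def)
  ultimately show "compose (points X) g f -` B \<inter> points X \<in> bounded_sets X" by simp
next
  fix U assume U: "U \<in> entourages X"
  show "map_prod (compose (points X) g f) (compose (points X) g f) ` U \<in> entourages Z"
    using bcs_morphism_image[OF g bcs_morphism_image[OF f U]]
    by (simp add: map_prod_image_compose[OF entourage_subset[OF assms(1) U]])
qed

section \<open>Initial and final structures\<close>

text \<open>Preimages of bounded sets are in general closed neither under subsets nor, across
  different indices, under unions. The rule \<open>empty\<close> keeps the result non-empty for an
  empty family.\<close>

inductive_set generated_bornology :: "'u set set \<Rightarrow> 'u set set" for G where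
  empty: "{} \<in> generated_bornology G"
| base: "B \<in> G \<Longrightarrow> B \<in> generated_bornology G"
| subset: "B \<in> generated_bornology G \<Longrightarrow> A \<subseteq> B \<Longrightarrow> A \<in> generated_bornology G"
| union: "A \<in> generated_bornology G \<Longrightarrow> B \<in> generated_bornology G \<Longrightarrow> A \<union> B \<in> generated_bornology G"

text \<open>The induction rule is the point: it reduces claims about entourages of a colimit to
  images of entourages of the factors and to stability under the coarse operations.\<close>

inductive_set generated_coarse_structure :: "'u set \<Rightarrow> ('u \<times> 'u) set set \<Rightarrow> ('u \<times> 'u) set set"
  for X G where
  diag: "Id_on X \<in> generated_coarse_structure X G"
| base: "U \<in> G \<Longrightarrow> U \<in> generated_coarse_structure X G"
| subset: "U \<in> generated_coarse_structure X G \<Longrightarrow> V \<subseteq> U \<Longrightarrow> V \<in> generated_coarse_structure X G"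
| union: "U \<in> generated_coarse_structure X G \<Longrightarrow> V \<in> generated_coarse_structure X G \<Longrightarrow>
    U \<union> V \<in> generated_coarse_structure X G"
| converse: "U \<in> generated_coarse_structure X G \<Longrightarrow> U\<inverse> \<in> generated_coarse_structure X G"
| comp: "U \<in> generated_coarse_structure X G \<Longrightarrow> V \<in> generated_coarse_structure X G \<Longrightarrow>
    U O V \<in> generated_coarse_structure X G"

text \<open>A predicate on \<open>L\<close> instead of a function of the family: \<open>L\<close>
  may then be a record with an extension field, such as an action, which is left open here.\<close>

definition initial_bcs ::
    "'i set \<Rightarrow> ('i \<Rightarrow> ('u, 'x) bcs_scheme) \<Rightarrow> ('i \<Rightarrow> 'u \<Rightarrow> 'u) \<Rightarrow> ('u, 'x) bcs_scheme \<Rightarrow> bool" where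
  "initial_bcs I X p L \<longleftrightarrow>
     (\<forall>i\<in>I. is_bcs (X i) \<and> p i \<in> points L \<rightarrow>\<^sub>E points (X i)) \<and>
     entourages L = {U. U \<subseteq> points L \<times> points L \<and> (\<forall>i\<in>I. map_prod (p i) (p i) ` U \<in> entourages (X i))} \<and>
     bounded_sets L = generated_bornology {p i -` B \<inter> points L | i B. i \<in> I \<and> B \<in> bounded_sets (X i)}"

text \<open>The bornology is the largest one that is compatible with \<open>entourages L\<close> and
  makes every \<open>p i\<close> proper: compatibility forces \<open>thickening U B\<close> to be
  bounded along with \<open>B\<close>, and properness then bounds its preimages.\<close>

definition final_bcs ::
    "'i set \<Rightarrow> ('i \<Rightarrow> ('u, 'x) bcs_scheme) \<Rightarrow> ('i \<Rightarrow> 'u \<Rightarrow> 'u) \<Rightarrow> ('u, 'x) bcs_scheme \<Rightarrow> bool" where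
  "final_bcs I X p L \<longleftrightarrow>
     (\<forall>i\<in>I. is_bcs (X i) \<and> p i \<in> points (X i) \<rightarrow>\<^sub>E points L) \<and>
     entourages L = generated_coarse_structure (points L)
       {map_prod (p i) (p i) ` U | i U. i \<in> I \<and> U \<in> entourages (X i)} \<and>
     bounded_sets L = {B. B \<subseteq> points L \<and> (\<forall>U\<in>entourages L. \<forall>i\<in>I.
       p i -` thickening U B \<inter> points (X i) \<in> bounded_sets (X i))}"

section \<open>The initial structure and its universal property\<close>

context
  fixes I :: "'i set" and X :: "'i \<Rightarrow> ('u, 'x) bcs_scheme" and p :: "'i \<Rightarrow> 'u \<Rightarrow> 'u"
    and L :: "('u, 'x) bcs_scheme"
  assumes L: "initial_bcs I X p L"
begin

lemma initial_factor: "i \<in> I \<Longrightarrow> is_bcs (X i)"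
  using L by (simp add: initial_bcs_def)

lemma initial_entourages:
  "U \<in> entourages L \<longleftrightarrow> U \<subseteq> points L \<times> points L \<and> (\<forall>i\<in>I. map_prod (p i) (p i) ` U \<in> entourages (X i))"
  using L by (simp add: initial_bcs_def)

lemma initial_bounded_sets:
  "bounded_sets L = generated_bornology {p i -` B \<inter> points L | i B. i \<in> I \<and> B \<in> bounded_sets (X i)}"
  using L by (simp add: initial_bcs_def)

lemma initial_map_in: "i \<in> I \<Longrightarrow> x \<in> points L \<Longrightarrow> p i x \<in> points (X i)"
  using L by (auto simp: initial_bcs_def)

text \<open>Compatibility is checked on generators: U[p^{-1}(C)] lies in p^{-1}((p x p)(U)[C]). For
  composition, the image of \<open>U O V\<close> can be smaller than the composite of the images,
  since \<open>p i\<close> may identify different intermediate points; closure under subsets absorbs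
  the difference.\<close>

lemma initial_is_bcs: "is_bcs L"
proof (rule is_bcsI)
  show "Id_on (points L) \<in> entourages L"
    unfolding initial_entourages
    using initial_map_in by (auto intro!: entourage_mono[OF initial_factor entourage_diag[OF initial_factor]])
next
  fix U V assume "U \<in> entourages L" "V \<subseteq> U"
  then show "V \<in> entourages L"
    unfolding initial_entourages by (blast intro: entourage_mono[OF initial_factor] image_mono)
next
  fix U V assume "U \<in> entourages L" "V \<in> entourages L"
  then show "U \<union> V \<in> entourages L"
    unfolding initial_entourages by (auto simp: image_Un intro: entourage_Un[OF initial_factor])
next
  fix U assume U: "U \<in> entourages L"
  have "map_prod (p i) (p i) ` U\<inverse> = (map_prod (p i) (p i) ` U)\<inverse>" for i by force
  with U show "U\<inverse> \<in> entourages L"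
    unfolding initial_entourages by (auto intro: entourage_converse[OF initial_factor])
next
  fix U V assume UV: "U \<in> entourages L" "V \<in> entourages L"
  have "map_prod (p i) (p i) ` (U O V) \<in> entourages (X i)" if i: "i \<in> I" for i
  proof (rule entourage_mono[OF initial_factor[OF i]])
    show "map_prod (p i) (p i) ` U O map_prod (p i) (p i) ` V \<in> entourages (X i)"
      using UV i by (simp add: initial_entourages entourage_comp[OF initial_factor])
  qed force
  with UV show "U O V \<in> entourages L"
    unfolding initial_entourages by auto
next
  fix B assume "B \<in> bounded_sets L"
  then show "B \<subseteq> points L"
    unfolding initial_bounded_sets by induction auto
next
  fix U B assume U: "U \<in> entourages L" and "B \<in> bounded_sets L"
  from this(2) show "thickening U B \<in> bounded_sets L"
    unfolding initial_bounded_sets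
  proof induction
    case empty
    then show ?case by (simp add: thickening_def generated_bornology.empty)
  next
    case (base B)
    then obtain i C where i: "i \<in> I" and C: "C \<in> bounded_sets (X i)" and B: "B = p i -` C \<inter> points L"
      by blast
    let ?C = "thickening (map_prod (p i) (p i) ` U) C"
    have "?C \<in> bounded_sets (X i)"
      using U i C by (auto simp: initial_entourages intro: bounded_thickening[OF initial_factor])
    moreover have "thickening U B \<subseteq> p i -` ?C \<inter> points L"
      using U B by (force simp: thickening_def initial_entourages)
    ultimately show ?case
      using i by (blast intro: generated_bornology.subset[OF generated_bornology.base])
  next
    case (subset B A)
    then show ?case by (elim generated_bornology.subset) (auto simp: thickening_def)
  next
    case (union A B)
    have "thickening U (A \<union> B) = thickening U A \<union> thickening U B" by (auto simp: thickening_def)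
    with union show ?case by (simp add: generated_bornology.union)
  qed
qed (auto simp: initial_entourages initial_bounded_sets intro: generated_bornology.intros)

lemma initial_map_morphism:
  assumes "i \<in> I"
  shows "p i \<in> bcs_morphisms L (X i)"
proof (rule bcs_morphismsI)
  show "p i \<in> points L \<rightarrow>\<^sub>E points (X i)"
    using L assms by (simp add: initial_bcs_def)
qed (use assms in \<open>auto simp: initial_entourages initial_bounded_sets intro!: generated_bornology.base\<close>)

lemma initial_morphismI:
  assumes Y: "is_bcs Y" and f: "f \<in> points Y \<rightarrow>\<^sub>E points L"
    and pf: "\<And>i. i \<in> I \<Longrightarrow> compose (points Y) (p i) f \<in> bcs_morphisms Y (X i)"
  shows "f \<in> bcs_morphisms Y L"
proof (rule bcs_morphismsI)
  fix B assume "B \<in> bounded_sets L"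
  then show "f -` B \<inter> points Y \<in> bounded_sets Y"
    unfolding initial_bounded_sets
  proof induction
    case empty
    then show ?case by (simp add: bounded_empty[OF Y])
  next
    case (base B)
    then obtain i C where i: "i \<in> I" and C: "C \<in> bounded_sets (X i)" and B: "B = p i -` C \<inter> points L"
      by blast
    have "f -` B \<inter> points Y = compose (points Y) (p i) f -` C \<inter> points Y"
      using f B by (auto simp: compose_def)
    with bcs_morphism_vimage[OF pf[OF i] C] show ?case by simp
  next
    case (subset B A)
    then show ?case by (elim bounded_mono[OF Y]) auto
  next
    case (union A B)
    then show ?case by (simp add: vimage_Un Int_Un_distrib2 bounded_Un[OF Y])
  qed
next
  fix U assume U: "U \<in> entourages Y"
  have "map_prod f f ` U \<subseteq> points L \<times> points L"
    using f entourage_subset[OF Y U] by auto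
  moreover have "map_prod (p i) (p i) ` map_prod f f ` U \<in> entourages (X i)" if "i \<in> I" for i
    using bcs_morphism_image[OF pf[OF that] U]
    by (simp only: map_prod_image_compose[OF entourage_subset[OF Y U]])
  ultimately show "map_prod f f ` U \<in> entourages L"
    by (simp add: initial_entourages)
qed (rule f)

end

section \<open>The final structure and its universal property\<close>

context
  fixes I :: "'i set" and X :: "'i \<Rightarrow> ('u, 'x) bcs_scheme" and p :: "'i \<Rightarrow> 'u \<Rightarrow> 'u"
    and L :: "('u, 'x) bcs_scheme"
  assumes L: "final_bcs I X p L"
begin

lemma final_factor: "i \<in> I \<Longrightarrow> is_bcs (X i)"
  using L by (simp add: final_bcs_def)

lemma final_entourages:
  "entourages L = generated_coarse_structure (points L)
     {map_prod (p i) (p i) ` U | i U. i \<in> I \<and> U \<in> entourages (X i)}"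
  using L by (simp add: final_bcs_def)

lemma final_bounded_sets:
  "B \<in> bounded_sets L \<longleftrightarrow> B \<subseteq> points L \<and> (\<forall>U\<in>entourages L. \<forall>i\<in>I.
     p i -` thickening U B \<inter> points (X i) \<in> bounded_sets (X i))"
  using L by (simp add: final_bcs_def)

lemma final_map_in: "i \<in> I \<Longrightarrow> x \<in> points (X i) \<Longrightarrow> p i x \<in> points L"
  using L by (auto simp: final_bcs_def)

lemma final_entourage_subset: "U \<in> entourages L \<Longrightarrow> U \<subseteq> points L \<times> points L"
  unfolding final_entourages
proof (induction rule: generated_coarse_structure.induct)
  case (base U)
  then show ?case
    using entourage_subset[OF final_factor] by (fastforce dest: final_map_in)
qed auto

text \<open>Compatibility comes from U[V[B]] = (U O V)[B]: the quantifier over all entourages of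
  \<open>L\<close> absorbs one more \<open>V\<close>. A test on the generating entourages alone
  would not be stable in this way, as they need not be closed under composition.\<close>

lemma final_is_bcs: "is_bcs L"
proof (rule is_bcsI)
  fix A B assume B: "B \<in> bounded_sets L" and AB: "A \<subseteq> B"
  have "p i -` thickening U A \<inter> points (X i) \<subseteq> p i -` thickening U B \<inter> points (X i)" for i U
    using AB by (auto simp: thickening_def)
  with B AB show "A \<in> bounded_sets L"
    unfolding final_bounded_sets by (meson bounded_mono final_factor subset_trans)
next
  fix A B assume "A \<in> bounded_sets L" "B \<in> bounded_sets L"
  moreover have "p i -` thickening U (A \<union> B) \<inter> points (X i) =
      (p i -` thickening U A \<inter> points (X i)) \<union> (p i -` thickening U B \<inter> points (X i))" for i U
    by (auto simp: thickening_def)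
  ultimately show "A \<union> B \<in> bounded_sets L"
    by (simp add: final_bounded_sets bounded_Un[OF final_factor])
next
  fix V B assume V: "V \<in> entourages L" and B: "B \<in> bounded_sets L"
  have "thickening U (thickening V B) = thickening (U O V) B" for U
    by (auto simp: thickening_def)
  moreover have "U O V \<in> entourages L" if "U \<in> entourages L" for U
    using that V unfolding final_entourages by (rule generated_coarse_structure.comp)
  moreover have "thickening V B \<subseteq> points L"
    using final_entourage_subset[OF V] by (auto simp: thickening_def)
  ultimately show "thickening V B \<in> bounded_sets L"
    using B by (simp add: final_bounded_sets)
qed (use final_entourage_subset in \<open>auto simp: final_entourages final_bounded_sets thickening_def
      bounded_empty[OF final_factor] intro: generated_coarse_structure.intros\<close>)

lemma final_map_morphism:
  assumes i: "i \<in> I"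
  shows "p i \<in> bcs_morphisms (X i) L"
proof (rule bcs_morphismsI)
  show "p i \<in> points (X i) \<rightarrow>\<^sub>E points L"
    using L i by (simp add: final_bcs_def)
  fix B assume B: "B \<in> bounded_sets L"
  \<comment> \<open>The diagonal is among the entourages tested, and thickening by it returns
    \<open>B\<close>.\<close>
  have "p i -` thickening (Id_on (points L)) B \<inter> points (X i) \<in> bounded_sets (X i)"
    using B i entourage_diag[OF final_is_bcs] by (simp add: final_bounded_sets)
  moreover have "thickening (Id_on (points L)) B = B"
    using B by (auto simp: final_bounded_sets thickening_def)
  ultimately show "p i -` B \<inter> points (X i) \<in> bounded_sets (X i)" by simp
next
  fix U assume "U \<in> entourages (X i)"
  then show "map_prod (p i) (p i) ` U \<in> entourages L"
    unfolding final_entourages using i by (blast intro: generated_coarse_structure.base)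
qed

text \<open>Control comes first because properness depends on it: U[f^{-1}(B)] lies in f^{-1}((f x
  f)(U)[B]), and the set (f x f)(U)[B] is bounded by compatibility of \<open>Y\<close>, so the
  composites with \<open>p i\<close> pull it back to bounded sets.\<close>

lemma final_morphismI:
  assumes Y: "is_bcs Y" and f: "f \<in> points L \<rightarrow>\<^sub>E points Y"
    and fp: "\<And>i. i \<in> I \<Longrightarrow> compose (points (X i)) f (p i) \<in> bcs_morphisms (X i) Y"
  shows "f \<in> bcs_morphisms L Y"
proof -
  have controlled: "map_prod f f ` U \<in> entourages Y" if "U \<in> entourages L" for U
    using that unfolding final_entourages
  proof induction
    case diag
    then show ?case
      using f by (auto intro!: entourage_mono[OF Y entourage_diag[OF Y]])
  next
    case (base V)
    then obtain i U where i: "i \<in> I" and U: "U \<in> entourages (X i)" and V: "V = map_prod (p i) (p i) ` U"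
      by blast
    show ?case
      using bcs_morphism_image[OF fp[OF i] U] V
      by (simp add: map_prod_image_compose[OF entourage_subset[OF final_factor[OF i] U]])
  next
    case (subset U V)
    then show ?case by (blast intro: entourage_mono[OF Y])
  next
    case (union U V)
    then show ?case by (simp add: image_Un entourage_Un[OF Y])
  next
    case (converse U)
    have "map_prod f f ` U\<inverse> = (map_prod f f ` U)\<inverse>" by force
    with converse show ?case by (simp add: entourage_converse[OF Y])
  next
    case (comp U V)
    show ?case
      by (rule entourage_mono[OF Y entourage_comp[OF Y comp.IH]]) force
  qed
  show ?thesis
  proof (rule bcs_morphismsI[OF f _ controlled])
    fix B assume B: "B \<in> bounded_sets Y"
    have "p i -` thickening U (f -` B \<inter> points L) \<inter> points (X i) \<in> bounded_sets (X i)"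
      if U: "U \<in> entourages L" and i: "i \<in> I" for U i
    proof (rule bounded_mono[OF final_factor[OF i] bcs_morphism_vimage[OF fp[OF i]]])
      show "thickening (map_prod f f ` U) B \<in> bounded_sets Y"
        by (intro bounded_thickening[OF Y] controlled U B)
      show "p i -` thickening U (f -` B \<inter> points L) \<inter> points (X i) \<subseteq>
          compose (points (X i)) f (p i) -` thickening (map_prod f f ` U) B \<inter> points (X i)"
        by (force simp: thickening_def compose_def)
    qed
    then show "f -` B \<inter> points L \<in> bounded_sets L"
      by (simp add: final_bounded_sets)
  qed
qed

end

section \<open>Limits and colimits of sets in the universe\<close>

lemma set_universe_subset: "set_universe \<I> \<U> \<Longrightarrow> A \<in> \<U> \<Longrightarrow> B \<lesssim> A \<Longrightarrow> B \<in> \<U>"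
  unfolding set_universe_def by blast

text \<open>The set is a copy, inside the universe, of the families in the product that satisfy
  \<open>P\<close>, and \<open>p i\<close> reads off a coordinate. The last two conclusions are
  existence and uniqueness of the point with given coordinates, the set-level universal
  property.\<close>

lemma set_universe_limit:
  assumes \<U>: "set_universe \<I> \<U>" and I: "I \<in> \<I>" and A: "A \<in> I \<rightarrow> \<U>"
  obtains L p where "L \<in> \<U>"
    and "\<And>i. i \<in> I \<Longrightarrow> p i \<in> L \<rightarrow>\<^sub>E A i"
    and "\<And>l. l \<in> L \<Longrightarrow> P (\<lambda>i\<in>I. p i l)"
    and "\<And>x. x \<in> (\<Pi>\<^sub>E i\<in>I. A i) \<Longrightarrow> P x \<Longrightarrow> \<exists>l\<in>L. \<forall>i\<in>I. p i l = x i"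
    and "\<And>l l'. l \<in> L \<Longrightarrow> l' \<in> L \<Longrightarrow> \<forall>i\<in>I. p i l = p i l' \<Longrightarrow> l = l'"
proof -
  obtain Q where Q: "Q \<in> \<U>" "(\<Pi>\<^sub>E i\<in>I. A i) \<lesssim> Q"
    using \<U> I A unfolding set_universe_def by (simp add: Pi_iff) blast
  then obtain e where e: "inj_on e (\<Pi>\<^sub>E i\<in>I. A i)" "e ` (\<Pi>\<^sub>E i\<in>I. A i) \<subseteq> Q"
    unfolding lepoll_def by blast
  define K where "K = {x \<in> (\<Pi>\<^sub>E i\<in>I. A i). P x}"
  define p where "p i = (\<lambda>l\<in>e ` K. inv_into K e l i)" for i
  have inj: "inj_on e K"
    using e(1) by (rule inj_on_subset) (auto simp: K_def)
  have p: "p i (e x) = x i" if "x \<in> K" for x i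
    using that inj by (simp add: p_def)
  show thesis
  proof (rule that[of "e ` K" p])
    have "e ` K \<lesssim> Q"
      using e(2) by (intro subset_imp_lepoll) (auto simp: K_def)
    then show "e ` K \<in> \<U>"
      by (rule set_universe_subset[OF \<U> Q(1)])
    show "p i \<in> e ` K \<rightarrow>\<^sub>E A i" if "i \<in> I" for i
    proof
      fix l assume "l \<in> e ` K"
      with p that show "p i l \<in> A i" by (auto simp: K_def)
    qed (simp add: p_def)
    show "P (\<lambda>i\<in>I. p i l)" if l: "l \<in> e ` K" for l
    proof -
      from l obtain x where x: "x \<in> K" "l = e x" by blast
      have "(\<lambda>i\<in>I. p i l) = x"
        using x by (auto simp: p K_def PiE_def extensional_def)
      with x show ?thesis by (simp add: K_def)
    qed
    show "\<exists>l\<in>e ` K. \<forall>i\<in>I. p i l = x i" if "x \<in> (\<Pi>\<^sub>E i\<in>I. A i)" "P x" for x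
      using that by (intro bexI[of _ "e x"]) (auto simp: p K_def)
    show "l = l'" if ll': "l \<in> e ` K" "l' \<in> e ` K" and eq: "\<forall>i\<in>I. p i l = p i l'" for l l'
    proof -
      from ll' obtain x x' where x: "x \<in> K" "l = e x" "x' \<in> K" "l' = e x'" by blast
      have "x = x'"
      proof (rule PiE_ext)
        show "x \<in> (\<Pi>\<^sub>E i\<in>I. A i)" "x' \<in> (\<Pi>\<^sub>E i\<in>I. A i)" using x by (auto simp: K_def)
        show "x i = x' i" if "i \<in> I" for i using eq that x by (simp add: p)
      qed
      with x show ?thesis by simp
    qed
  qed
qed

text \<open>The colimit is the disjoint union modulo the equivalence relation generated by
  \<open>R\<close>. Classes would be sets of pairs, so a representative of each is chosen and
  encoded by \<open>e\<close> instead. The maps \<open>q\<close> take values in \<open>'u\<close>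
  because all objects of the category have points of this type.\<close>

lemma set_universe_colimit:
  fixes R :: "('i \<times> 'u) rel"
  assumes \<U>: "set_universe \<I> \<U>" and I: "I \<in> \<I>" and A: "A \<in> I \<rightarrow> \<U>"
    and R: "R \<subseteq> (SIGMA i:I. A i) \<times> (SIGMA i:I. A i)"
  obtains L p where "L \<in> \<U>"
    and "\<And>i. i \<in> I \<Longrightarrow> p i \<in> A i \<rightarrow>\<^sub>E L"
    and "L = (\<Union>i\<in>I. p i ` A i)"
    and "\<And>i x j y. ((i, x), (j, y)) \<in> R \<Longrightarrow> p i x = p j y"
    and "\<And>q :: 'i \<Rightarrow> 'u \<Rightarrow> 'u. \<forall>((i, x), (j, y))\<in>R. q i x = q j y \<Longrightarrow>
           \<exists>h\<in>extensional L. \<forall>i\<in>I. \<forall>x\<in>A i. h (p i x) = q i x"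
proof -
  obtain Q where Q: "Q \<in> \<U>" "(SIGMA i:I. A i) \<lesssim> Q"
    using \<U> I A unfolding set_universe_def by (simp add: Pi_iff) blast
  then obtain e where e: "inj_on e (SIGMA i:I. A i)" "e ` (SIGMA i:I. A i) \<subseteq> Q"
    unfolding lepoll_def by blast
  \<comment> \<open>\<open>S\<close> is reflexive on the whole type, so every pair has a
    representative; \<open>rep_in\<close> keeps representatives of the disjoint union inside
    it.\<close>
  define S where "S = (R \<union> R\<inverse>)\<^sup>*"
  have sym: "(z, y) \<in> S" if "(y, z) \<in> S" for y z
    using that unfolding S_def by (rule symD[OF sym_rtrancl[OF sym_Un_converse]])
  have trans: "(x, z) \<in> S" if "(x, y) \<in> S" "(y, z) \<in> S" for x y z
    using that by (simp add: S_def)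
  define rep where "rep y = (SOME z. (y, z) \<in> S)" for y
  have rep: "(y, rep y) \<in> S" for y
    unfolding rep_def by (rule someI[of _ y]) (simp add: S_def)
  have rep_in: "rep y \<in> (SIGMA i:I. A i)" if "y \<in> (SIGMA i:I. A i)" for y
    using rep[of y] unfolding S_def by (induction rule: rtrancl_induct) (use R that in auto)
  have rep_eq: "rep y = rep z" if "(y, z) \<in> R" for y z
  proof -
    \<comment> \<open>Related pairs have the same candidates, so the choice operator returns the
      same one for both.\<close>
    have "(y, w) \<in> S \<longleftrightarrow> (z, w) \<in> S" for w
      using that sym trans by (metis S_def UnI1 r_into_rtrancl)
    then show ?thesis by (simp add: rep_def)
  qed
  define p where "p i = (\<lambda>x\<in>A i. e (rep (i, x)))" for i
  define L where "L = (\<Union>i\<in>I. p i ` A i)"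
  show thesis
  proof (rule that[of L p])
    have "L \<subseteq> Q"
      using e(2) rep_in by (auto simp: L_def p_def)
    then show "L \<in> \<U>"
      by (intro set_universe_subset[OF \<U> Q(1)] subset_imp_lepoll)
    show "p i \<in> A i \<rightarrow>\<^sub>E L" if "i \<in> I" for i
      using that by (auto simp: L_def p_def)
    show "p i x = p j y" if "((i, x), (j, y)) \<in> R" for i x j y
      using that R rep_eq[OF that] by (auto simp: p_def)
    show "\<exists>h\<in>extensional L. \<forall>i\<in>I. \<forall>x\<in>A i. h (p i x) = q i x"
      if q: "\<forall>((i, x), (j, y))\<in>R. q i x = q j y" for q :: "'i \<Rightarrow> 'u \<Rightarrow> 'u"
    proof -
      have q_rep: "case_prod q (rep y) = case_prod q y" for y
        using rep[of y] unfolding S_def by (induction rule: rtrancl_induct) (use q in fastforce)+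
      \<comment> \<open>Decoding a point of \<open>L\<close> yields a representative, on which
        \<open>q\<close> has the same value as on the original pair by \<open>q_rep\<close>.\<close>
      define h where "h = (\<lambda>l\<in>L. case_prod q (inv_into (SIGMA i:I. A i) e l))"
      have "h (p i x) = q i x" if "i \<in> I" "x \<in> A i" for i x
        using that q_rep[of "(i, x)"] inv_into_f_f[OF e(1) rep_in[of "(i, x)"]]
        by (auto simp: h_def p_def L_def)
      moreover have "h \<in> extensional L" by (simp add: h_def)
      ultimately show ?thesis by blast
    qed
  qed (fact L_def)
qed

section \<open>Equivariant spaces\<close>

lemma bcs_truncate_simps [simp]:
  "points (bcs.truncate X) = points X"
  "entourages (bcs.truncate X) = entourages X"
  "bounded_sets (bcs.truncate X) = bounded_sets X"
  by (simp_all add: bcs.truncate_def)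

lemma is_bcs_truncate [simp]: "is_bcs (bcs.truncate X) = is_bcs X"
  by (simp add: is_bcs_def)

lemma bcs_morphisms_truncate [simp]:
  "bcs_morphisms (bcs.truncate X) (bcs.truncate Y) = bcs_morphisms X Y"
  by (simp add: bcs_morphisms_def proper_def controlled_def)

lemma is_equivariant_bcsD:
  assumes "is_equivariant_bcs \<Gamma> X"
  shows equivariant_is_bcs: "is_bcs X"
    and action_morphism: "\<gamma> \<in> carrier \<Gamma> \<Longrightarrow> action X \<gamma> \<in> bcs_morphisms X X"
    and action_one: "x \<in> points X \<Longrightarrow> action X \<one>\<^bsub>\<Gamma>\<^esub> x = x"
    and action_mult: "\<gamma> \<in> carrier \<Gamma> \<Longrightarrow> \<delta> \<in> carrier \<Gamma> \<Longrightarrow> x \<in> points X \<Longrightarrow>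
      action X (\<gamma> \<otimes>\<^bsub>\<Gamma>\<^esub> \<delta>) x = action X \<gamma> (action X \<delta> x)"
    and entourage_invariant: "U \<in> entourages X \<Longrightarrow>
      \<exists>V\<in>entourages X. invariant_under \<Gamma> (action X) V \<and> U \<subseteq> V"
proof -
  show "action X \<gamma> \<in> bcs_morphisms X X" if "\<gamma> \<in> carrier \<Gamma>"
    using assms that by (auto simp: is_equivariant_bcs_def automorphism_def BornCoarse_def)
  interpret group_action \<Gamma> "points X" "action X"
    using assms by (simp add: is_equivariant_bcs_def)
  show "action X \<one>\<^bsub>\<Gamma>\<^esub> x = x" if "x \<in> points X"
    using that id_eq_one by (metis restrict_apply')
  show "action X (\<gamma> \<otimes>\<^bsub>\<Gamma>\<^esub> \<delta>) x = action X \<gamma> (action X \<delta> x)"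
    if "\<gamma> \<in> carrier \<Gamma>" "\<delta> \<in> carrier \<Gamma>" "x \<in> points X"
    using that by (simp add: composition_rule)
qed (use assms in \<open>auto simp: is_equivariant_bcs_def\<close>)

text \<open>Inverses in \<Gamma> supply the rest of the definition: bijectivity of
  \<open>action X \<gamma>\<close>, its inverse morphism, and equality in invariance. Indeed, if
  \<gamma>^{-1} V is contained in V, then V = \<gamma> (\<gamma>^{-1} V) is contained in \<gamma> V,
  so one inclusion for all \<gamma> is enough.\<close>

lemma is_equivariant_bcsI:
  assumes \<Gamma>: "group \<Gamma>" and X: "is_bcs X"
    and morphism: "\<And>\<gamma>. \<gamma> \<in> carrier \<Gamma> \<Longrightarrow> action X \<gamma> \<in> bcs_morphisms X X"
    and one: "\<And>x. x \<in> points X \<Longrightarrow> action X \<one>\<^bsub>\<Gamma>\<^esub> x = x"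
    and mult: "\<And>\<gamma> \<delta> x. \<gamma> \<in> carrier \<Gamma> \<Longrightarrow> \<delta> \<in> carrier \<Gamma> \<Longrightarrow> x \<in> points X \<Longrightarrow>
      action X (\<gamma> \<otimes>\<^bsub>\<Gamma>\<^esub> \<delta>) x = action X \<gamma> (action X \<delta> x)"
    and invariant: "\<And>U. U \<in> entourages X \<Longrightarrow> \<exists>V\<in>entourages X. U \<subseteq> V \<and>
      (\<forall>\<gamma>\<in>carrier \<Gamma>. map_prod (action X \<gamma>) (action X \<gamma>) ` V \<subseteq> V)"
  shows "is_equivariant_bcs \<Gamma> X"
proof -
  interpret \<Gamma>: group \<Gamma> by (rule \<Gamma>)
  have inverse: "action X \<gamma> (action X (inv\<^bsub>\<Gamma>\<^esub> \<gamma>) x) = x" "action X (inv\<^bsub>\<Gamma>\<^esub> \<gamma>) (action X \<gamma> x) = x"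
    if "\<gamma> \<in> carrier \<Gamma>" "x \<in> points X" for \<gamma> x
    using that by (simp_all flip: mult add: one)
  note closed = bcs_morphism_in[OF morphism]
  have Bij: "action X \<gamma> \<in> Bij (points X)" if "\<gamma> \<in> carrier \<Gamma>" for \<gamma>
  proof -
    have "bij_betw (action X \<gamma>) (points X) (points X)"
      by (rule bij_betw_byWitness[of _ "action X (inv\<^bsub>\<Gamma>\<^esub> \<gamma>)"])
        (use that in \<open>auto simp: inverse closed\<close>)
    then show ?thesis
      using bcs_morphism_PiE[OF morphism[OF that]] by (simp add: Bij_def PiE_iff)
  qed
  have "action X \<in> hom \<Gamma> (BijGroup (points X))"
  proof (rule homI)
    fix \<gamma> \<delta> assume "\<gamma> \<in> carrier \<Gamma>" "\<delta> \<in> carrier \<Gamma>"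
    moreover from this have "action X (\<gamma> \<otimes>\<^bsub>\<Gamma>\<^esub> \<delta>) = compose (points X) (action X \<gamma>) (action X \<delta>)"
      using Bij_imp_extensional[OF Bij[of "\<gamma> \<otimes>\<^bsub>\<Gamma>\<^esub> \<delta>"]]
      by (intro extensionalityI[where A = "points X"]) (auto simp: compose_def mult)
    ultimately show "action X (\<gamma> \<otimes>\<^bsub>\<Gamma>\<^esub> \<delta>) = action X \<gamma> \<otimes>\<^bsub>BijGroup (points X)\<^esub> action X \<delta>"
      by (simp add: BijGroup_def Bij)
  qed (simp add: BijGroup_def Bij)
  then have "group_action \<Gamma> (points X) (action X)"
    by (simp add: group_action_def group_hom_def group_hom_axioms_def \<Gamma> group_BijGroup)
  moreover have "automorphism (BornCoarse UNIV) (bcs.truncate X) (action X \<gamma>)"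
    if \<gamma>: "\<gamma> \<in> carrier \<Gamma>" for \<gamma>
    unfolding automorphism_def
  proof (intro conjI bexI)
    show "action X (inv\<^bsub>\<Gamma>\<^esub> \<gamma>) \<in> Hom (BornCoarse UNIV) (bcs.truncate X) (bcs.truncate X)"
      using \<gamma> by (simp add: BornCoarse_def morphism)
  qed (use \<gamma> in \<open>auto simp: BornCoarse_def morphism compose_def inverse\<close>)
  moreover have "\<exists>V\<in>entourages X. invariant_under \<Gamma> (action X) V \<and> U \<subseteq> V"
    if U: "U \<in> entourages X" for U
  proof -
    from invariant[OF U] obtain V where V: "V \<in> entourages X" "U \<subseteq> V"
      and inv: "\<And>\<gamma>. \<gamma> \<in> carrier \<Gamma> \<Longrightarrow> map_prod (action X \<gamma>) (action X \<gamma>) ` V \<subseteq> V" by blast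
    have "V \<subseteq> map_prod (action X \<gamma>) (action X \<gamma>) ` V" if \<gamma>: "\<gamma> \<in> carrier \<Gamma>" for \<gamma>
    proof (rule subsetI, clarify)
      fix x y assume xy: "(x, y) \<in> V"
      then have "(action X (inv\<^bsub>\<Gamma>\<^esub> \<gamma>) x, action X (inv\<^bsub>\<Gamma>\<^esub> \<gamma>) y) \<in> V"
        using inv[of "inv\<^bsub>\<Gamma>\<^esub> \<gamma>"] \<gamma> by auto
      moreover have "x \<in> points X" "y \<in> points X"
        using xy entourage_subset[OF X V(1)] by auto
      ultimately show "(x, y) \<in> map_prod (action X \<gamma>) (action X \<gamma>) ` V"
        using \<gamma> by (metis inverse(1) map_prod_imageI)
    qed
    with inv have "invariant_under \<Gamma> (action X) V"
      unfolding invariant_under_def by blast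
    with V show ?thesis by blast
  qed
  ultimately show ?thesis
    using X by (simp add: is_equivariant_bcs_def)
qed

section \<open>The category of equivariant spaces\<close>

lemma EquivariantBornCoarse_simps [simp]:
  "Ob (EquivariantBornCoarse \<Gamma> \<U>) = {X. is_equivariant_bcs \<Gamma> X \<and> points X \<in> \<U>}"
  "Hom (EquivariantBornCoarse \<Gamma> \<U>) X Y = equivariant_morphisms \<Gamma> X Y"
  "Ident (EquivariantBornCoarse \<Gamma> \<U>) X = (\<lambda>x\<in>points X. x)"
  "Comp (EquivariantBornCoarse \<Gamma> \<U>) X Y Z g f = compose (points X) g f"
  by (simp_all add: EquivariantBornCoarse_def)

lemma equivariant_morphisms_iff:
  "f \<in> equivariant_morphisms \<Gamma> X Y \<longleftrightarrow> f \<in> bcs_morphisms X Y \<and>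
     (\<forall>\<gamma>\<in>carrier \<Gamma>. \<forall>x\<in>points X. f (action X \<gamma> x) = action Y \<gamma> (f x))"
  by (simp add: equivariant_morphisms_def)

lemma category_EquivariantBornCoarse: "category (EquivariantBornCoarse \<Gamma> \<U>)"
proof -
  have "(\<lambda>x\<in>points X. x) \<in> equivariant_morphisms \<Gamma> X X" if "is_equivariant_bcs \<Gamma> X" for X
    using that bcs_morphism_in[OF action_morphism[OF that]]
    by (simp add: equivariant_morphisms_iff bcs_morphisms_id equivariant_is_bcs)
  moreover have "compose (points X) g f \<in> equivariant_morphisms \<Gamma> X Z"
    if "is_equivariant_bcs \<Gamma> X" "f \<in> equivariant_morphisms \<Gamma> X Y" "g \<in> equivariant_morphisms \<Gamma> Y Z"
    for X Y Z f g
    using that bcs_morphism_in[OF action_morphism[OF that(1)]] bcs_morphism_in[of f X Y]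
    by (auto simp: equivariant_morphisms_iff bcs_morphisms_compose[OF equivariant_is_bcs] compose_eq)
  moreover have "compose (points X) f (\<lambda>x\<in>points X. x) = f" "compose (points X) (\<lambda>y\<in>points Y. y) f = f"
    if "f \<in> equivariant_morphisms \<Gamma> X Y" for X Y f
    using that by (auto simp: equivariant_morphisms_iff bcs_morphisms_def compose_def PiE_iff
        extensional_def fun_eq_iff)
  moreover have "compose (points W) h (compose (points W) g f) = compose (points W) (compose (points X) h g) f"
    if "f \<in> equivariant_morphisms \<Gamma> W X" for W X f g h
    using bcs_morphism_in[of f W X] that
    by (auto simp: equivariant_morphisms_iff compose_def fun_eq_iff)
  ultimately show ?thesis
    unfolding category_def EquivariantBornCoarse_simps
    by (intro conjI ballI; elim CollectE conjE; blast)
qed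

text \<open>The maps \<open>p i\<close> separate points, so the laws of the action can be checked in
  the factors. For invariance, choose an invariant \<open>V i\<close> above each image of
  \<open>U\<close> and intersect the preimages; infinitely many factors do no harm, because
  membership in \<open>entourages L\<close> is tested one factor at a time.\<close>

lemma initial_equivariant:
  assumes \<Gamma>: "group \<Gamma>" and X: "\<And>i. i \<in> I \<Longrightarrow> is_equivariant_bcs \<Gamma> (X i)"
    and L: "initial_bcs I X p L"
    and inj: "\<And>l l'. l \<in> points L \<Longrightarrow> l' \<in> points L \<Longrightarrow> (\<And>i. i \<in> I \<Longrightarrow> p i l = p i l') \<Longrightarrow> l = l'"
    and act: "\<And>\<gamma>. \<gamma> \<in> carrier \<Gamma> \<Longrightarrow> action L \<gamma> \<in> points L \<rightarrow>\<^sub>E points L"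
    and p_act: "\<And>\<gamma> l i. \<gamma> \<in> carrier \<Gamma> \<Longrightarrow> l \<in> points L \<Longrightarrow> i \<in> I \<Longrightarrow>
      p i (action L \<gamma> l) = action (X i) \<gamma> (p i l)"
  shows "is_equivariant_bcs \<Gamma> L"
proof -
  interpret group \<Gamma> by (rule \<Gamma>)
  note bcs = equivariant_is_bcs[OF X]
  note bcs_L = initial_is_bcs[OF L]
  note p = initial_map_morphism[OF L]
  have act_in: "action L \<gamma> l \<in> points L" if "\<gamma> \<in> carrier \<Gamma>" "l \<in> points L" for \<gamma> l
    using act[OF that(1)] that(2) by auto
  show ?thesis
  proof (rule is_equivariant_bcsI[OF \<Gamma> bcs_L])
    fix \<gamma> assume \<gamma>: "\<gamma> \<in> carrier \<Gamma>"
    show "action L \<gamma> \<in> bcs_morphisms L L"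
    proof (rule initial_morphismI[OF L bcs_L act[OF \<gamma>]])
      fix i assume i: "i \<in> I"
      have "compose (points L) (p i) (action L \<gamma>) = compose (points L) (action (X i) \<gamma>) (p i)"
        by (auto simp: compose_def p_act[OF \<gamma> _ i])
      then show "compose (points L) (p i) (action L \<gamma>) \<in> bcs_morphisms L (X i)"
        using bcs_morphisms_compose[OF bcs_L p[OF i] action_morphism[OF X[OF i] \<gamma>]] by simp
    qed
  next
    fix l assume l: "l \<in> points L"
    show "action L \<one>\<^bsub>\<Gamma>\<^esub> l = l"
      by (rule inj) (use l in \<open>simp_all add: act_in p_act action_one[OF X] bcs_morphism_in[OF p]\<close>)
  next
    fix \<gamma> \<delta> l assume *: "\<gamma> \<in> carrier \<Gamma>" "\<delta> \<in> carrier \<Gamma>" "l \<in> points L"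
    show "action L (\<gamma> \<otimes>\<^bsub>\<Gamma>\<^esub> \<delta>) l = action L \<gamma> (action L \<delta> l)"
      by (rule inj) (use * in \<open>simp_all add: act_in p_act action_mult[OF X] bcs_morphism_in[OF p]\<close>)
  next
    fix U assume U: "U \<in> entourages L"
    then have "\<forall>i\<in>I. \<exists>V\<in>entourages (X i). invariant_under \<Gamma> (action (X i)) V \<and> map_prod (p i) (p i) ` U \<subseteq> V"
      by (simp add: bcs_morphism_image[OF p] entourage_invariant[OF X])
    then obtain V where V: "\<And>i. i \<in> I \<Longrightarrow> V i \<in> entourages (X i)"
      and inv: "\<And>i. i \<in> I \<Longrightarrow> invariant_under \<Gamma> (action (X i)) (V i)"
      and UV: "\<And>i. i \<in> I \<Longrightarrow> map_prod (p i) (p i) ` U \<subseteq> V i"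
      by metis
    define W where "W = {(a, b) \<in> points L \<times> points L. \<forall>i\<in>I. (p i a, p i b) \<in> V i}"
    have "map_prod (p i) (p i) ` W \<in> entourages (X i)" if "i \<in> I" for i
      by (rule entourage_mono[OF bcs[OF that] V[OF that]]) (use that in \<open>auto simp: W_def\<close>)
    then have "W \<in> entourages L"
      by (auto simp: initial_entourages[OF L] W_def)
    moreover have "U \<subseteq> W"
      using UV entourage_subset[OF bcs_L U] by (fastforce simp: W_def)
    moreover have "map_prod (action L \<gamma>) (action L \<gamma>) ` W \<subseteq> W" if \<gamma>: "\<gamma> \<in> carrier \<Gamma>" for \<gamma>
    proof -
      have "(action (X i) \<gamma> x, action (X i) \<gamma> y) \<in> V i" if "i \<in> I" "(x, y) \<in> V i" for i x y
        using inv[OF that(1)] \<gamma> that(2) unfolding invariant_under_def by (metis map_prod_imageI)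
      then show ?thesis
        using \<gamma> by (auto simp: W_def act_in p_act)
    qed
    ultimately show "\<exists>V\<in>entourages L. U \<subseteq> V \<and>
        (\<forall>\<gamma>\<in>carrier \<Gamma>. map_prod (action L \<gamma>) (action L \<gamma>) ` V \<subseteq> V)"
      by blast
  qed
qed

text \<open>Every point of \<open>L\<close> has the form \<open>p i x\<close>, so
  \<open>act_p\<close> determines the action and transfers its laws. A generated entourage has no
  explicit description, so the invariant one above it is found by induction: images of invariant
  entourages are invariant because \<open>p i\<close> is equivariant, and each closure rule
  preserves the existence of an invariant superset.\<close>

lemma final_equivariant:
  assumes \<Gamma>: "group \<Gamma>" and X: "\<And>i. i \<in> I \<Longrightarrow> is_equivariant_bcs \<Gamma> (X i)"
    and L: "final_bcs I X p L"
    and surj: "points L = (\<Union>i\<in>I. p i ` points (X i))"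
    and act: "\<And>\<gamma>. \<gamma> \<in> carrier \<Gamma> \<Longrightarrow> action L \<gamma> \<in> extensional (points L)"
    and act_p: "\<And>\<gamma> i x. \<gamma> \<in> carrier \<Gamma> \<Longrightarrow> i \<in> I \<Longrightarrow> x \<in> points (X i) \<Longrightarrow>
      action L \<gamma> (p i x) = p i (action (X i) \<gamma> x)"
  shows "is_equivariant_bcs \<Gamma> L"
proof -
  interpret group \<Gamma> by (rule \<Gamma>)
  note bcs = equivariant_is_bcs[OF X]
  note bcs_L = final_is_bcs[OF L]
  note p = final_map_morphism[OF L]
  note X_act_in = bcs_morphism_in[OF action_morphism[OF X]]
  have act_in: "action L \<gamma> l \<in> points L" if "\<gamma> \<in> carrier \<Gamma>" "l \<in> points L" for \<gamma> l
  proof -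
    from that(2) obtain i x where "i \<in> I" "x \<in> points (X i)" "l = p i x"
      by (auto simp: surj)
    with that(1) show ?thesis
      by (simp add: act_p X_act_in bcs_morphism_in[OF p])
  qed
  let ?G = "{map_prod (p i) (p i) ` U | i U. i \<in> I \<and> U \<in> entourages (X i)}"
  show ?thesis
  proof (rule is_equivariant_bcsI[OF \<Gamma> bcs_L])
    fix \<gamma> assume \<gamma>: "\<gamma> \<in> carrier \<Gamma>"
    show "action L \<gamma> \<in> bcs_morphisms L L"
    proof (rule final_morphismI[OF L bcs_L])
      show "action L \<gamma> \<in> points L \<rightarrow>\<^sub>E points L"
        using act[OF \<gamma>] act_in[OF \<gamma>] by (simp add: PiE_iff)
      fix i assume i: "i \<in> I"
      have "compose (points (X i)) (action L \<gamma>) (p i) = compose (points (X i)) (p i) (action (X i) \<gamma>)"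
        by (auto simp: compose_def act_p[OF \<gamma> i])
      then show "compose (points (X i)) (action L \<gamma>) (p i) \<in> bcs_morphisms (X i) L"
        using bcs_morphisms_compose[OF bcs[OF i] action_morphism[OF X[OF i] \<gamma>] p[OF i]] by simp
    qed
  next
    fix l assume "l \<in> points L"
    then show "action L \<one>\<^bsub>\<Gamma>\<^esub> l = l"
      by (auto simp: surj act_p action_one[OF X])
  next
    fix \<gamma> \<delta> l assume "\<gamma> \<in> carrier \<Gamma>" "\<delta> \<in> carrier \<Gamma>" "l \<in> points L"
    then show "action L (\<gamma> \<otimes>\<^bsub>\<Gamma>\<^esub> \<delta>) l = action L \<gamma> (action L \<delta> l)"
      by (auto simp: surj act_p action_mult[OF X] X_act_in)
  next
    fix U assume "U \<in> entourages L"
    then show "\<exists>V\<in>entourages L. U \<subseteq> V \<and>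
        (\<forall>\<gamma>\<in>carrier \<Gamma>. map_prod (action L \<gamma>) (action L \<gamma>) ` V \<subseteq> V)"
      unfolding final_entourages[OF L]
    proof induction
      case diag
      show ?case
        by (rule bexI[OF _ generated_coarse_structure.diag]) (auto simp: act_in)
    next
      case (base W)
      then obtain i U where i: "i \<in> I" and U: "U \<in> entourages (X i)" and W: "W = map_prod (p i) (p i) ` U"
        by blast
      obtain V where V: "V \<in> entourages (X i)" "U \<subseteq> V" and inv: "invariant_under \<Gamma> (action (X i)) V"
        using entourage_invariant[OF X[OF i] U] by blast
      have "map_prod (action L \<gamma>) (action L \<gamma>) ` map_prod (p i) (p i) ` V \<subseteq> map_prod (p i) (p i) ` V"
        if \<gamma>: "\<gamma> \<in> carrier \<Gamma>" for \<gamma>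
      proof -
        have "(action L \<gamma> (p i x), action L \<gamma> (p i y)) \<in> map_prod (p i) (p i) ` V" if xy: "(x, y) \<in> V" for x y
        proof -
          have "(action (X i) \<gamma> x, action (X i) \<gamma> y) \<in> V"
            using inv \<gamma> xy unfolding invariant_under_def by (metis map_prod_imageI)
          moreover have "x \<in> points (X i)" "y \<in> points (X i)"
            using xy entourage_subset[OF bcs[OF i] V(1)] by auto
          ultimately show ?thesis
            by (simp add: act_p[OF \<gamma> i] map_prod_imageI)
        qed
        then show ?thesis by auto
      qed
      moreover have "W \<subseteq> map_prod (p i) (p i) ` V"
        unfolding W using V(2) by (rule image_mono)
      moreover have "map_prod (p i) (p i) ` V \<in> generated_coarse_structure (points L) ?G"
        using i V(1) by (intro generated_coarse_structure.base) blast
      ultimately show ?case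
        by (intro bexI[of _ "map_prod (p i) (p i) ` V"] conjI ballI)
    next
      case (subset U V)
      then show ?case by blast
    next
      case (union U\<^sub>1 U\<^sub>2)
      then obtain V\<^sub>1 V\<^sub>2 where V: "V\<^sub>1 \<in> generated_coarse_structure (points L) ?G"
          "V\<^sub>2 \<in> generated_coarse_structure (points L) ?G"
        and "U\<^sub>1 \<subseteq> V\<^sub>1" "U\<^sub>2 \<subseteq> V\<^sub>2"
        and "\<forall>\<gamma>\<in>carrier \<Gamma>. map_prod (action L \<gamma>) (action L \<gamma>) ` V\<^sub>1 \<subseteq> V\<^sub>1"
            "\<forall>\<gamma>\<in>carrier \<Gamma>. map_prod (action L \<gamma>) (action L \<gamma>) ` V\<^sub>2 \<subseteq> V\<^sub>2"
        by auto
      then show ?case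
        by (intro bexI[OF _ generated_coarse_structure.union[OF V]]) (simp add: image_Un, blast)
    next
      case (converse U)
      then obtain V where V: "V \<in> generated_coarse_structure (points L) ?G"
        and "U \<subseteq> V" "\<forall>\<gamma>\<in>carrier \<Gamma>. map_prod (action L \<gamma>) (action L \<gamma>) ` V \<subseteq> V"
        by auto
      then show ?case
        by (intro bexI[OF _ generated_coarse_structure.converse[OF V]]) auto
    next
      case (comp U\<^sub>1 U\<^sub>2)
      then obtain V\<^sub>1 V\<^sub>2 where V: "V\<^sub>1 \<in> generated_coarse_structure (points L) ?G"
          "V\<^sub>2 \<in> generated_coarse_structure (points L) ?G"
        and "U\<^sub>1 \<subseteq> V\<^sub>1" "U\<^sub>2 \<subseteq> V\<^sub>2"
        and inv: "\<And>\<gamma>. \<gamma>\<in>carrier \<Gamma> \<Longrightarrow> map_prod (action L \<gamma>) (action L \<gamma>) ` V\<^sub>1 \<subseteq> V\<^sub>1"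
            "\<And>\<gamma>. \<gamma>\<in>carrier \<Gamma> \<Longrightarrow> map_prod (action L \<gamma>) (action L \<gamma>) ` V\<^sub>2 \<subseteq> V\<^sub>2"
        by auto
      have "map_prod (action L \<gamma>) (action L \<gamma>) ` (V\<^sub>1 O V\<^sub>2) \<subseteq> V\<^sub>1 O V\<^sub>2" if \<gamma>: "\<gamma> \<in> carrier \<Gamma>" for \<gamma>
      proof -
        \<comment> \<open>Any map sends a chain through \<open>V\<^sub>1\<close> and
          \<open>V\<^sub>2\<close> to a chain through their images.\<close>
        have "map_prod (action L \<gamma>) (action L \<gamma>) ` (V\<^sub>1 O V\<^sub>2) \<subseteq>
            map_prod (action L \<gamma>) (action L \<gamma>) ` V\<^sub>1 O map_prod (action L \<gamma>) (action L \<gamma>) ` V\<^sub>2"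
          by force
        also have "\<dots> \<subseteq> V\<^sub>1 O V\<^sub>2"
          by (rule relcomp_mono[OF inv[OF \<gamma>]])
        finally show ?thesis .
      qed
      with \<open>U\<^sub>1 \<subseteq> V\<^sub>1\<close> \<open>U\<^sub>2 \<subseteq> V\<^sub>2\<close> show ?case
        by (intro bexI[OF _ generated_coarse_structure.comp[OF V]]) (simp add: relcomp_mono)
    qed
  qed
qed

section \<open>Limits and colimits\<close>

text \<open>\<open>lift\<close> is the universal property on points: compatible coordinates come
  from a point of \<open>K\<close>. Applied to the translates of the coordinates of a point it gives
  the action, applied to the values of the legs of a cone it gives the mediating map. Equivariance
  and uniqueness of that map follow from joint injectivity.\<close>

lemma complete_EquivariantBornCoarse:
  fixes \<Gamma> :: "('g, 'e) monoid_scheme" and \<I> :: "'i set set" and \<U> :: "'u set set"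
  assumes \<Gamma>: "group \<Gamma>" and \<U>: "set_universe \<I> \<U>"
  shows "complete_category \<I> (EquivariantBornCoarse \<Gamma> \<U>)"
  unfolding complete_category_def
proof (intro conjI category_EquivariantBornCoarse allI impI, elim conjE)
  fix J :: "('i, 'i) cat" and D :: "('i, 'i, ('u, 'g) equivariant_bcs, 'u \<Rightarrow> 'u) diagram"
  assume J: "small_category \<I> J" and D: "is_diagram J (EquivariantBornCoarse \<Gamma> \<U>) D"
  let ?I = "Ob J" and ?X = "DOb D"
  let ?P = "\<lambda>x. \<forall>i\<in>Ob J. \<forall>j\<in>Ob J. \<forall>u\<in>Hom J i j. DMor D i j u (x i) = x j"
  have X: "is_equivariant_bcs \<Gamma> (?X i)" "points (?X i) \<in> \<U>" if "i \<in> ?I" for i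
    using D that by (auto simp: is_diagram_def)
  have D_equiv: "DMor D i j u (action (?X i) \<gamma> x) = action (?X j) \<gamma> (DMor D i j u x)"
    if "i \<in> ?I" "j \<in> ?I" "u \<in> Hom J i j" "x \<in> points (?X i)" "\<gamma> \<in> carrier \<Gamma>" for i j u x \<gamma>
    using D that by (auto simp: is_diagram_def equivariant_morphisms_iff)
  note X_act_in = bcs_morphism_in[OF action_morphism[OF X(1)]]
  have I: "?I \<in> \<I>" using J by (simp add: small_category_def)
  have X_\<U>: "(\<lambda>i. points (?X i)) \<in> ?I \<rightarrow> \<U>" using X(2) by simp
  obtain K p where K: "K \<in> \<U>"
    and p: "\<And>i. i \<in> ?I \<Longrightarrow> p i \<in> K \<rightarrow>\<^sub>E points (?X i)"
    and P: "\<And>l. l \<in> K \<Longrightarrow> ?P (\<lambda>i\<in>?I. p i l)"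
    and ex: "\<And>x. x \<in> (\<Pi>\<^sub>E i\<in>?I. points (?X i)) \<Longrightarrow> ?P x \<Longrightarrow> \<exists>l\<in>K. \<forall>i\<in>?I. p i l = x i"
    and joint_inj: "\<And>l l'. l \<in> K \<Longrightarrow> l' \<in> K \<Longrightarrow> \<forall>i\<in>?I. p i l = p i l' \<Longrightarrow> l = l'"
    using that by (rule set_universe_limit[OF \<U> I X_\<U>, where P = ?P])
  have inj: "l = l'" if "l \<in> K" "l' \<in> K" "\<And>i. i \<in> ?I \<Longrightarrow> p i l = p i l'" for l l'
    using that by (simp add: joint_inj)
  have p_in: "p i l \<in> points (?X i)" if "i \<in> ?I" "l \<in> K" for i l
    using p that by blast
  have D_p: "DMor D i j u (p i l) = p j l" if "i \<in> ?I" "j \<in> ?I" "u \<in> Hom J i j" "l \<in> K" for i j u l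
    using P[OF that(4)] that(1-3) by simp
  have lift: "\<exists>l. l \<in> K \<and> (\<forall>i\<in>?I. p i l = x i)"
    if "\<And>i. i \<in> ?I \<Longrightarrow> x i \<in> points (?X i)" "?P x" for x
    using ex[of "restrict x ?I"] that by auto
  \<comment> \<open>The translated family is compatible because the maps of the diagram are
    equivariant.\<close>
  have "\<exists>l'. l' \<in> K \<and> (\<forall>i\<in>?I. p i l' = action (?X i) \<gamma> (p i l))" if "\<gamma> \<in> carrier \<Gamma>" "l \<in> K" for \<gamma> l
    using that by (intro lift) (simp_all add: X_act_in p_in D_equiv D_p)
  then obtain a where a: "\<And>\<gamma> l. \<gamma> \<in> carrier \<Gamma> \<Longrightarrow> l \<in> K \<Longrightarrow> a \<gamma> l \<in> K"
    and p_a: "\<And>\<gamma> l i. \<gamma> \<in> carrier \<Gamma> \<Longrightarrow> l \<in> K \<Longrightarrow> i \<in> ?I \<Longrightarrow> p i (a \<gamma> l) = action (?X i) \<gamma> (p i l)"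
    by metis
  \<comment> \<open>\<open>a\<close> results from a choice and is arbitrary off \<open>K\<close>;
    \<open>restrict\<close> makes it extensional, as morphisms must be.\<close>
  define L where "L = \<lparr>points = K,
    entourages = {U. U \<subseteq> K \<times> K \<and> (\<forall>i\<in>?I. map_prod (p i) (p i) ` U \<in> entourages (?X i))},
    bounded_sets = generated_bornology {p i -` B \<inter> K | i B. i \<in> ?I \<and> B \<in> bounded_sets (?X i)},
    action = (\<lambda>\<gamma>. restrict (a \<gamma>) K)\<rparr>"
  have L_simps [simp]: "points L = K" "action L = (\<lambda>\<gamma>. restrict (a \<gamma>) K)"
    by (simp_all add: L_def)
  have initial: "initial_bcs ?I ?X p L"
    using p by (simp add: initial_bcs_def L_def equivariant_is_bcs[OF X(1)])
  have L: "is_equivariant_bcs \<Gamma> L"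
    by (rule initial_equivariant[OF \<Gamma> X(1) initial]) (auto simp: a p_a intro: inj)
  note initial_rules = initial_map_morphism[OF initial]
    initial_morphismI[OF initial]
  have "is_limit J (EquivariantBornCoarse \<Gamma> \<U>) D L p"
    unfolding is_limit_def
  proof (intro conjI allI impI)
    have "compose K (DMor D i j u) (p i) = p j"
      if "i \<in> ?I" "j \<in> ?I" "u \<in> Hom J i j" for i j u
      using that p[OF that(2)] by (intro extensionalityI[where A = K]) (auto simp: compose_def D_p PiE_iff)
    moreover have "p i \<in> equivariant_morphisms \<Gamma> L (?X i)" if "i \<in> ?I" for i
      using that by (simp add: equivariant_morphisms_iff initial_rules p_a)
    ultimately show "is_cone J (EquivariantBornCoarse \<Gamma> \<U>) D L p"
      by (simp add: is_cone_def L K)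
  next
    fix Y q assume cone: "is_cone J (EquivariantBornCoarse \<Gamma> \<U>) D Y q"
    then have Y: "is_equivariant_bcs \<Gamma> Y" and q: "\<And>i. i \<in> ?I \<Longrightarrow> q i \<in> equivariant_morphisms \<Gamma> Y (?X i)"
      and D_q: "\<And>i j u. i \<in> ?I \<Longrightarrow> j \<in> ?I \<Longrightarrow> u \<in> Hom J i j \<Longrightarrow> compose (points Y) (DMor D i j u) (q i) = q j"
      by (simp_all add: is_cone_def)
    have q_bcs: "q i \<in> bcs_morphisms Y (?X i)" if "i \<in> ?I" for i
      using q[OF that] by (simp add: equivariant_morphisms_iff)
    have "\<exists>l. l \<in> K \<and> (\<forall>i\<in>?I. p i l = q i y)" if "y \<in> points Y" for y
    proof (rule lift)
      show "?P (\<lambda>i. q i y)"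
        using that by (auto simp flip: D_q simp: compose_eq)
    qed (use that bcs_morphism_in[OF q_bcs] in auto)
    then obtain h where h: "\<And>y. y \<in> points Y \<Longrightarrow> h y \<in> K"
      and p_h: "\<And>y i. y \<in> points Y \<Longrightarrow> i \<in> ?I \<Longrightarrow> p i (h y) = q i y"
      by metis
    note Y_act_in = bcs_morphism_in[OF action_morphism[OF Y]]
    have p_h': "compose (points Y) (p i) (restrict h (points Y)) = q i" if "i \<in> ?I" for i
      using that bcs_morphism_PiE[OF q_bcs[OF that]]
      by (intro extensionalityI[where A = "points Y"]) (auto simp: compose_def p_h PiE_iff)
    show "\<exists>!h. h \<in> Hom (EquivariantBornCoarse \<Gamma> \<U>) Y L \<and>
        (\<forall>i\<in>?I. Comp (EquivariantBornCoarse \<Gamma> \<U>) Y L (?X i) (p i) h = q i)"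
    proof (intro ex1I conjI)
      have "restrict h (points Y) \<in> bcs_morphisms Y L"
        using h by (intro initial_rules(2)) (auto simp: p_h' q_bcs equivariant_is_bcs[OF Y])
      moreover have "h (action Y \<gamma> y) = a \<gamma> (h y)" if "\<gamma> \<in> carrier \<Gamma>" "y \<in> points Y" for \<gamma> y
        by (rule inj) (use that q in \<open>auto simp: h a p_h p_a Y_act_in equivariant_morphisms_iff\<close>)
      ultimately show "restrict h (points Y) \<in> Hom (EquivariantBornCoarse \<Gamma> \<U>) Y L"
        by (simp add: equivariant_morphisms_iff h Y_act_in)
      show "\<forall>i\<in>?I. Comp (EquivariantBornCoarse \<Gamma> \<U>) Y L (?X i) (p i) (restrict h (points Y)) = q i"
        by (simp add: p_h')
    next
      fix g assume g: "g \<in> Hom (EquivariantBornCoarse \<Gamma> \<U>) Y L \<and>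
        (\<forall>i\<in>?I. Comp (EquivariantBornCoarse \<Gamma> \<U>) Y L (?X i) (p i) g = q i)"
      then have g_PiE: "g \<in> points Y \<rightarrow>\<^sub>E K"
        using bcs_morphism_PiE[of g Y L] by (simp add: equivariant_morphisms_iff)
      have p_g: "p i (g y) = q i y" if "i \<in> ?I" "y \<in> points Y" for i y
        using g that compose_eq[of y "points Y" "p i" g] by auto
      have "g y = h y" if "y \<in> points Y" for y
        by (rule inj) (use that g_PiE in \<open>auto simp: h p_g p_h\<close>)
      with g_PiE show "g = restrict h (points Y)"
        by (intro extensionalityI[where A = "points Y"]) (auto simp: PiE_iff)
    qed
  qed
  then show "\<exists>L p. is_limit J (EquivariantBornCoarse \<Gamma> \<U>) D L p"
    by blast
qed

text \<open>Dually to \<open>lift\<close>, \<open>descend\<close> says that maps out of the factors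
  which agree along the diagram induce a map out of \<open>K\<close>. The maps x \<mapsto>
  p_i(\<gamma> x) give the action, the legs of a cocone give the mediating map. Both are extensional
  from the start, and equations on \<open>K\<close> are checked on points
  \<open>p i x\<close>.\<close>

lemma cocomplete_EquivariantBornCoarse:
  fixes \<Gamma> :: "('g, 'e) monoid_scheme" and \<I> :: "'i set set" and \<U> :: "'u set set"
  assumes \<Gamma>: "group \<Gamma>" and \<U>: "set_universe \<I> \<U>"
  shows "cocomplete_category \<I> (EquivariantBornCoarse \<Gamma> \<U>)"
  unfolding cocomplete_category_def
proof (intro conjI category_EquivariantBornCoarse allI impI, elim conjE)
  fix J :: "('i, 'i) cat" and D :: "('i, 'i, ('u, 'g) equivariant_bcs, 'u \<Rightarrow> 'u) diagram"
  assume J: "small_category \<I> J" and D: "is_diagram J (EquivariantBornCoarse \<Gamma> \<U>) D"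
  let ?I = "Ob J" and ?X = "DOb D"
  have X: "is_equivariant_bcs \<Gamma> (?X i)" "points (?X i) \<in> \<U>" if "i \<in> ?I" for i
    using D that by (auto simp: is_diagram_def)
  have D_mor: "DMor D i j u \<in> bcs_morphisms (?X i) (?X j)"
    if "i \<in> ?I" "j \<in> ?I" "u \<in> Hom J i j" for i j u
    using D that by (auto simp: is_diagram_def equivariant_morphisms_iff)
  have D_equiv: "DMor D i j u (action (?X i) \<gamma> x) = action (?X j) \<gamma> (DMor D i j u x)"
    if "i \<in> ?I" "j \<in> ?I" "u \<in> Hom J i j" "x \<in> points (?X i)" "\<gamma> \<in> carrier \<Gamma>" for i j u x \<gamma>
    using D that by (auto simp: is_diagram_def equivariant_morphisms_iff)
  note X_act_in = bcs_morphism_in[OF action_morphism[OF X(1)]]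
  \<comment> \<open>Only the generating identifications; the equivalence closure is formed in
    \<open>set_universe_colimit\<close>.\<close>
  define R where "R = {((i, x), (j, DMor D i j u x)) | i j u x.
    i \<in> ?I \<and> j \<in> ?I \<and> u \<in> Hom J i j \<and> x \<in> points (?X i)}"
  have R: "R \<subseteq> (SIGMA i:?I. points (?X i)) \<times> (SIGMA i:?I. points (?X i))"
    using bcs_morphism_in[OF D_mor] by (auto simp: R_def)
  have I: "?I \<in> \<I>" using J by (simp add: small_category_def)
  have X_\<U>: "(\<lambda>i. points (?X i)) \<in> ?I \<rightarrow> \<U>" using X(2) by simp
  obtain K p where K: "K \<in> \<U>"
    and p: "\<And>i. i \<in> ?I \<Longrightarrow> p i \<in> points (?X i) \<rightarrow>\<^sub>E K"
    and surj: "K = (\<Union>i\<in>?I. p i ` points (?X i))"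
    and p_R: "\<And>i x j y. ((i, x), (j, y)) \<in> R \<Longrightarrow> p i x = p j y"
    and ex: "\<And>q :: 'i \<Rightarrow> 'u \<Rightarrow> 'u. \<forall>((i, x), (j, y))\<in>R. q i x = q j y \<Longrightarrow>
        \<exists>h\<in>extensional K. \<forall>i\<in>?I. \<forall>x\<in>points (?X i). h (p i x) = q i x"
    using that by (rule set_universe_colimit[OF \<U> I X_\<U> R])
  have p_in: "p i x \<in> K" if "i \<in> ?I" "x \<in> points (?X i)" for i x
    using p that by blast
  have p_D: "p j (DMor D i j u x) = p i x"
    if "i \<in> ?I" "j \<in> ?I" "u \<in> Hom J i j" "x \<in> points (?X i)" for i j u x
    using that by (intro p_R[symmetric]) (auto simp: R_def)
  have descend: "\<exists>h. h \<in> extensional K \<and> (\<forall>i\<in>?I. \<forall>x\<in>points (?X i). h (p i x) = q i x)"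
    if "\<And>i j u x. i \<in> ?I \<Longrightarrow> j \<in> ?I \<Longrightarrow> u \<in> Hom J i j \<Longrightarrow> x \<in> points (?X i) \<Longrightarrow> q j (DMor D i j u x) = q i x"
    for q :: "'i \<Rightarrow> 'u \<Rightarrow> 'u"
  proof -
    have "\<forall>((i, x), (j, y))\<in>R. q i x = q j y"
      using that by (auto simp: R_def)
    from ex[OF this] show ?thesis by blast
  qed
  \<comment> \<open>Agreement along a map D of the diagram: p_j(\<gamma> D(x)) = p_j(D(\<gamma> x))
    = p_i(\<gamma> x).\<close>
  have "\<exists>h. h \<in> extensional K \<and> (\<forall>i\<in>?I. \<forall>x\<in>points (?X i). h (p i x) = p i (action (?X i) \<gamma> x))"
    if "\<gamma> \<in> carrier \<Gamma>" for \<gamma>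
    using that by (intro descend) (simp flip: D_equiv add: p_D X_act_in)
  then obtain a where a: "\<And>\<gamma>. \<gamma> \<in> carrier \<Gamma> \<Longrightarrow> a \<gamma> \<in> extensional K"
    and a_p: "\<And>\<gamma> i x. \<gamma> \<in> carrier \<Gamma> \<Longrightarrow> i \<in> ?I \<Longrightarrow> x \<in> points (?X i) \<Longrightarrow> a \<gamma> (p i x) = p i (action (?X i) \<gamma> x)"
    by metis
  \<comment> \<open>Named beforehand because the bornology of \<open>L\<close> refers to the
    entourages of \<open>L\<close> itself.\<close>
  define C where "C = generated_coarse_structure K
    {map_prod (p i) (p i) ` U | i U. i \<in> ?I \<and> U \<in> entourages (?X i)}"
  define L where "L = \<lparr>points = K, entourages = C,
    bounded_sets = {B. B \<subseteq> K \<and> (\<forall>U\<in>C. \<forall>i\<in>?I.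
      p i -` thickening U B \<inter> points (?X i) \<in> bounded_sets (?X i))},
    action = a\<rparr>"
  have L_simps [simp]: "points L = K" "action L = a"
    by (simp_all add: L_def)
  have final: "final_bcs ?I ?X p L"
    using p by (simp add: final_bcs_def L_def C_def equivariant_is_bcs[OF X(1)])
  have L: "is_equivariant_bcs \<Gamma> L"
    by (rule final_equivariant[OF \<Gamma> X(1) final]) (simp_all add: a a_p flip: surj)
  note final_rules = final_map_morphism[OF final]
    final_morphismI[OF final]
  have "is_colimit J (EquivariantBornCoarse \<Gamma> \<U>) D L p"
    unfolding is_colimit_def
  proof (intro conjI allI impI)
    have "compose (points (?X i)) (p j) (DMor D i j u) = p i"
      if "i \<in> ?I" "j \<in> ?I" "u \<in> Hom J i j" for i j u
      using that p[OF that(1)]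
      by (intro extensionalityI[where A = "points (?X i)"]) (auto simp: compose_def p_D PiE_iff)
    moreover have "p i \<in> equivariant_morphisms \<Gamma> (?X i) L" if "i \<in> ?I" for i
      using that by (simp add: equivariant_morphisms_iff final_rules a_p)
    ultimately show "is_cocone J (EquivariantBornCoarse \<Gamma> \<U>) D L p"
      by (simp add: is_cocone_def L K)
  next
    fix Y q assume cocone: "is_cocone J (EquivariantBornCoarse \<Gamma> \<U>) D Y q"
    then have Y: "is_equivariant_bcs \<Gamma> Y" and q: "\<And>i. i \<in> ?I \<Longrightarrow> q i \<in> equivariant_morphisms \<Gamma> (?X i) Y"
      and q_D: "\<And>i j u. i \<in> ?I \<Longrightarrow> j \<in> ?I \<Longrightarrow> u \<in> Hom J i j \<Longrightarrow>
        compose (points (?X i)) (q j) (DMor D i j u) = q i"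
      by (simp_all add: is_cocone_def)
    have q_bcs: "q i \<in> bcs_morphisms (?X i) Y" if "i \<in> ?I" for i
      using q[OF that] by (simp add: equivariant_morphisms_iff)
    have "\<exists>h. h \<in> extensional K \<and> (\<forall>i\<in>?I. \<forall>x\<in>points (?X i). h (p i x) = q i x)"
      by (rule descend) (metis q_D compose_eq)
    then obtain h where h: "h \<in> extensional K"
      and h_p: "\<And>i x. i \<in> ?I \<Longrightarrow> x \<in> points (?X i) \<Longrightarrow> h (p i x) = q i x"
      by blast
    have h_p': "compose (points (?X i)) h (p i) = q i" if "i \<in> ?I" for i
      using that bcs_morphism_PiE[OF q_bcs[OF that]]
      by (intro extensionalityI[where A = "points (?X i)"]) (auto simp: compose_def h_p PiE_iff)
    show "\<exists>!h. h \<in> Hom (EquivariantBornCoarse \<Gamma> \<U>) L Y \<and>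
        (\<forall>i\<in>?I. Comp (EquivariantBornCoarse \<Gamma> \<U>) (?X i) L Y h (p i) = q i)"
    proof (intro ex1I conjI)
      have "h l \<in> points Y" if "l \<in> K" for l
        using that bcs_morphism_in[OF q_bcs] by (auto simp: surj h_p)
      with h have "h \<in> bcs_morphisms L Y"
        by (intro final_rules(2)) (auto simp: PiE_iff h_p' q_bcs equivariant_is_bcs[OF Y])
      moreover have "h (a \<gamma> l) = action Y \<gamma> (h l)" if "\<gamma> \<in> carrier \<Gamma>" "l \<in> K" for \<gamma> l
        using that q by (auto simp: surj a_p h_p X_act_in equivariant_morphisms_iff)
      ultimately show "h \<in> Hom (EquivariantBornCoarse \<Gamma> \<U>) L Y"
        by (simp add: equivariant_morphisms_iff)
      show "\<forall>i\<in>?I. Comp (EquivariantBornCoarse \<Gamma> \<U>) (?X i) L Y h (p i) = q i"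
        by (simp add: h_p')
    next
      fix g assume g: "g \<in> Hom (EquivariantBornCoarse \<Gamma> \<U>) L Y \<and>
        (\<forall>i\<in>?I. Comp (EquivariantBornCoarse \<Gamma> \<U>) (?X i) L Y g (p i) = q i)"
      then have "g \<in> extensional K"
        using bcs_morphism_PiE[of g L Y] by (simp add: equivariant_morphisms_iff PiE_iff)
      moreover have "g (p i x) = q i x" if "i \<in> ?I" "x \<in> points (?X i)" for i x
        using g that compose_eq[of x "points (?X i)" g "p i"] by auto
      then have "g l = h l" if "l \<in> K" for l
        using that by (auto simp: surj h_p)
      ultimately show "g = h"
        using h by (intro extensionalityI[where A = K])
    qed
  qed
  then show "\<exists>L p. is_colimit J (EquivariantBornCoarse \<Gamma> \<U>) D L p"
    by blast
qed

section \<open>Forgetting a trivial action\<close>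

context
  fixes C :: "('o, 'm) cat" and C' :: "('p, 'm) cat" and G :: "'p \<Rightarrow> 'o"
  assumes surj: "G ` Ob C' = Ob C"
    and Hom: "\<And>X Y. X \<in> Ob C' \<Longrightarrow> Y \<in> Ob C' \<Longrightarrow> Hom C' X Y = Hom C (G X) (G Y)"
    and Ident: "\<And>X. X \<in> Ob C' \<Longrightarrow> Ident C' X = Ident C (G X)"
    and Comp: "\<And>X Y Z. X \<in> Ob C' \<Longrightarrow> Y \<in> Ob C' \<Longrightarrow> Z \<in> Ob C' \<Longrightarrow>
      Comp C' X Y Z = Comp C (G X) (G Y) (G Z)"
begin

text \<open>The two categories share the type of morphisms, and corresponding hom-sets are equal,
  not merely in bijection. Diagrams and cones are thus lifted by changing objects alone: a preimage
  under \<open>G\<close> is chosen for each object, and the arrows are kept.\<close>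

definition "section_ob = inv_into (Ob C') G"

lemma section_ob:
  "X \<in> Ob C \<Longrightarrow> section_ob X \<in> Ob C'" "X \<in> Ob C \<Longrightarrow> G (section_ob X) = X" "Y \<in> Ob C' \<Longrightarrow> G Y \<in> Ob C"
  using surj by (auto simp: section_ob_def inv_into_into f_inv_into_f)

lemma category_image: "category C' \<Longrightarrow> category C"
  unfolding category_def surj[symmetric] by (simp add: Hom Ident Comp)

definition "section_diagram D = \<lparr>DOb = section_ob \<circ> DOb D, DMor = DMor D\<rparr>"

lemma section_diagram_simps:
  "DOb (section_diagram D) i = section_ob (DOb D i)" "DMor (section_diagram D) = DMor D"
  by (simp_all add: section_diagram_def)

lemma section_diagram:
  assumes "is_diagram J C D"
  shows "is_diagram J C' (section_diagram D)"
  using assms by (simp add: is_diagram_def section_diagram_simps section_ob Hom Ident Comp)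

context
  fixes J :: "('i, 'k) cat" and D :: "('i, 'k, 'o, 'm) diagram"
  assumes D: "is_diagram J C D"
begin

lemma DOb_in: "i \<in> Ob J \<Longrightarrow> DOb D i \<in> Ob C"
  using D by (simp add: is_diagram_def)

lemma is_cone_section: "X \<in> Ob C' \<Longrightarrow> is_cone J C' (section_diagram D) X q \<longleftrightarrow> is_cone J C D (G X) q"
  by (simp add: is_cone_def section_diagram_simps section_ob DOb_in Hom Comp)

lemma is_cocone_section: "X \<in> Ob C' \<Longrightarrow> is_cocone J C' (section_diagram D) X q \<longleftrightarrow> is_cocone J C D (G X) q"
  by (simp add: is_cocone_def section_diagram_simps section_ob DOb_in Hom Comp)

text \<open>A cone with vertex \<open>X\<close> lifts, with the same legs, to the vertex
  \<open>section_ob X\<close>. Since hom-sets and composites agree, the unique mediating arrow for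
  the lifted cone is also the unique one for the original.\<close>

lemma is_limit_image:
  assumes "is_limit J C' (section_diagram D) L p"
  shows "is_limit J C D (G L) p"
proof -
  have L: "L \<in> Ob C'" using assms by (simp add: is_limit_def is_cone_def)
  have "\<exists>!h. h \<in> Hom C X (G L) \<and> (\<forall>i\<in>Ob J. Comp C X (G L) (DOb D i) (p i) h = q i)"
    if "is_cone J C D X q" for X q
  proof -
    have X: "X \<in> Ob C" using that by (simp add: is_cone_def)
    with that have "is_cone J C' (section_diagram D) (section_ob X) q"
      by (simp add: is_cone_section section_ob)
    with assms have "\<exists>!h. h \<in> Hom C' (section_ob X) L \<and>
        (\<forall>i\<in>Ob J. Comp C' (section_ob X) L (section_ob (DOb D i)) (p i) h = q i)"
      by (simp add: is_limit_def section_diagram_simps)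
    with X L show ?thesis
      by (simp add: Hom Comp section_ob DOb_in)
  qed
  with assms L show ?thesis
    by (simp add: is_limit_def is_cone_section)
qed

lemma is_colimit_image:
  assumes "is_colimit J C' (section_diagram D) L p"
  shows "is_colimit J C D (G L) p"
proof -
  have L: "L \<in> Ob C'" using assms by (simp add: is_colimit_def is_cocone_def)
  have "\<exists>!h. h \<in> Hom C (G L) X \<and> (\<forall>i\<in>Ob J. Comp C (DOb D i) (G L) X h (p i) = q i)"
    if "is_cocone J C D X q" for X q
  proof -
    have X: "X \<in> Ob C" using that by (simp add: is_cocone_def)
    with that have "is_cocone J C' (section_diagram D) (section_ob X) q"
      by (simp add: is_cocone_section section_ob)
    with assms have "\<exists>!h. h \<in> Hom C' L (section_ob X) \<and>
        (\<forall>i\<in>Ob J. Comp C' (section_ob (DOb D i)) L (section_ob X) h (p i) = q i)"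
      by (simp add: is_colimit_def section_diagram_simps)
    with X L show ?thesis
      by (simp add: Hom Comp section_ob DOb_in)
  qed
  with assms L show ?thesis
    by (simp add: is_colimit_def is_cocone_section)
qed

end

lemma complete_category_image: "complete_category \<I> C' \<Longrightarrow> complete_category \<I> C"
  unfolding complete_category_def using category_image section_diagram is_limit_image by metis

lemma cocomplete_category_image: "cocomplete_category \<I> C' \<Longrightarrow> cocomplete_category \<I> C"
  unfolding cocomplete_category_def using category_image section_diagram is_colimit_image by metis

end

section \<open>Plain spaces as spaces with an action of the trivial group\<close>

lemma BornCoarse_simps [simp]:
  "Ob (BornCoarse \<U>) = {X. is_bcs X \<and> points X \<in> \<U>}"
  "Hom (BornCoarse \<U>) X Y = bcs_morphisms X Y"
  "Ident (BornCoarse \<U>) X = (\<lambda>x\<in>points X. x)"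
  "Comp (BornCoarse \<U>) X Y Z g f = compose (points X) g f"
  by (simp_all add: BornCoarse_def)

text \<open>A preimage of a space is obtained by letting the group act by the identity, under which
  every entourage is invariant. Conversely, \<open>()\<close> is the identity element and therefore
  acts trivially on every object, so equivariance holds automatically and the hom-sets
  coincide.\<close>

lemma truncate_trivial_action:
  defines "\<Gamma> \<equiv> singleton_group ()"
  shows "bcs.truncate ` Ob (EquivariantBornCoarse \<Gamma> \<U>) = Ob (BornCoarse \<U>)"
    and "X \<in> Ob (EquivariantBornCoarse \<Gamma> \<U>) \<Longrightarrow> Y \<in> Ob (EquivariantBornCoarse \<Gamma> \<U>) \<Longrightarrow>
      Hom (EquivariantBornCoarse \<Gamma> \<U>) X Y = Hom (BornCoarse \<U>) (bcs.truncate X) (bcs.truncate Y)"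
proof -
  have \<Gamma>: "group \<Gamma>" "carrier \<Gamma> = {()}" by (simp_all add: \<Gamma>_def)
  have "X \<in> bcs.truncate ` Ob (EquivariantBornCoarse \<Gamma> \<U>)" if X: "is_bcs X" "points X \<in> \<U>" for X
  proof
    define Y :: "('a, unit) equivariant_bcs" where
      "Y = \<lparr>points = points X, entourages = entourages X, bounded_sets = bounded_sets X,
        action = (\<lambda>_. \<lambda>x\<in>points X. x)\<rparr>"
    show trunc: "X = bcs.truncate Y"
      by (simp add: Y_def bcs.truncate_def)
    have Y_bcs: "is_bcs Y"
      using X(1) by (simp add: trunc)
    have act: "action Y \<gamma> = (\<lambda>x\<in>points Y. x)" for \<gamma>
      by (simp add: Y_def)
    have "is_equivariant_bcs \<Gamma> Y"
    proof (rule is_equivariant_bcsI[OF \<Gamma>(1) Y_bcs])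
      fix U assume U: "U \<in> entourages Y"
      have "map_prod (\<lambda>x\<in>points Y. x) (\<lambda>x\<in>points Y. x) ` U \<subseteq> U"
        using entourage_subset[OF Y_bcs U] by auto
      with U show "\<exists>V\<in>entourages Y. U \<subseteq> V \<and>
          (\<forall>\<gamma>\<in>carrier \<Gamma>. map_prod (action Y \<gamma>) (action Y \<gamma>) ` V \<subseteq> V)"
        by (auto simp: act)
    qed (simp_all add: act bcs_morphisms_id[OF Y_bcs])
    then show "Y \<in> Ob (EquivariantBornCoarse \<Gamma> \<U>)"
      using X(2) by (simp add: Y_def)
  qed
  then show "bcs.truncate ` Ob (EquivariantBornCoarse \<Gamma> \<U>) = Ob (BornCoarse \<U>)"
    by (auto simp: equivariant_is_bcs)
  have trivial: "action X \<gamma> x = x" if "is_equivariant_bcs \<Gamma> X" "x \<in> points X" for X :: "('a, unit) equivariant_bcs" and \<gamma> x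
    using action_one[OF that] by simp
  show "Hom (EquivariantBornCoarse \<Gamma> \<U>) X Y = Hom (BornCoarse \<U>) (bcs.truncate X) (bcs.truncate Y)"
    if "X \<in> Ob (EquivariantBornCoarse \<Gamma> \<U>)" "Y \<in> Ob (EquivariantBornCoarse \<Gamma> \<U>)"
    using that bcs_morphism_in[of _ X Y] by (auto simp: equivariant_morphisms_iff trivial)
qed

theorem theorem5p8:
  fixes \<Gamma> :: "('g, 'e) monoid_scheme"
    and \<I> :: "'i set set" and \<U> :: "'u set set"
  assumes "group \<Gamma>"
    and "set_universe \<I> \<U>"
  shows "complete_category \<I> (BornCoarse \<U>) \<and>
    cocomplete_category \<I> (BornCoarse \<U>) \<and>
    complete_category \<I> (EquivariantBornCoarse \<Gamma> \<U>) \<and>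
    cocomplete_category \<I> (EquivariantBornCoarse \<Gamma> \<U>)"
proof -
  \<comment> \<open>The plain half comes from the trivial group, whatever \<Gamma> is. Identities
    and composites agree because both are formed from \<open>points\<close>, which truncation
    keeps.\<close>
  let ?C = "EquivariantBornCoarse (singleton_group ()) \<U>"
  have Ident: "Ident ?C X = Ident (BornCoarse \<U>) (bcs.truncate X)" for X
    by simp
  have Comp: "Comp ?C X Y Z = Comp (BornCoarse \<U>) (bcs.truncate X) (bcs.truncate Y) (bcs.truncate Z)" for X Y Z
    by (simp add: fun_eq_iff)
  have "complete_category \<I> (BornCoarse \<U>)"
    by (rule complete_category_image[OF truncate_trivial_action Ident Comp
          complete_EquivariantBornCoarse[OF singleton_group assms(2)]])
  moreover have "cocomplete_category \<I> (BornCoarse \<U>)"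
    by (rule cocomplete_category_image[OF truncate_trivial_action Ident Comp
          cocomplete_EquivariantBornCoarse[OF singleton_group assms(2)]])
  ultimately show ?thesis
    by (simp add: assms complete_EquivariantBornCoarse cocomplete_EquivariantBornCoarse)
qed

end
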